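(* Let $\{(G_n,w_n)\}_{n\ge1}$ be a nifty family of weighted graphs. Then $\{X_{(G_\lambda,w_\lambda)}\}_{\lambda\vdash n\ge0}$ is a multiplicative basis for $\operatorname{Sym}$. Moreover, the extended chromatic symmetric functions $\{X_{(G_n,w_n)}\}_{n\ge1}$ are algebraically independent and freely generate $\operatorname{Sym}$.
   Context: $\operatorname{Sym}=\bigoplus_{n\ge0}\operatorname{Sym}^n\subseteq\mathbb{Q}[[x_1,x_2,\dots]]$ is the graded algebra of symmetric functions over $\mathbb{Q}$. A basis $\{b_\lambda\}_{\lambda\vdash n\ge0}$ of $\operatorname{Sym}$ indexed by all partitions (including the empty one) is multiplicative if for each $n\ge 0$, $\operatorname{Sym}^n=\operatorname{span}\{b_\lambda\}_{\lambda\vdash n}$, and $b_\lambda=\prod_{i=1}^{\ell(\lambda)}b_{\lambda_i}$ for every partition $\lambda=(\lambda_1,\dots,\lambda_{\ell(\lambda)})$ (empty product $=1$). A weighted graph $(G,w)$ is a finite graph $G$ with a weight function $w:V(G)\to\mathbb{Z}^+$. A proper colouring is a map $\kappa:V(G)\to\mathbb{Z}^+$ with $\kappa(u)\neq\kappa(v)$ whenever $uv$ is an edge. The extended chromatic symmetric function of $(G,w)$, with vertices $v_1,\dots,v_N$, is $X_{(G,w)}=\sum_\kappa x_{\kappa(v_1)}^{w(v_1)}\cdots x_{\kappa(v_N)}^{w(v_N)}$, summed over all proper colourings $\kappa$ of $G$. A family $\{(G_n,w_n)\}_{n\ge1}$ of simple (no loops, no multiple edges) connected weighted graphs is nifty if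 the sum of the vertex weights of each $(G_n,w_n)$ is exactly $n$. For a partition $\lambda=(\lambda_1,\dots,\lambda_{\ell(\lambda)})$, $(G_\lambda,w_\lambda)$ is the disjoint union of weighted graphs $(G_{\lambda_1},w_{\lambda_1})\cup\cdots\cup(G_{\lambda_{\ell(\lambda)}},w_{\lambda_{\ell(\lambda)}})$. *)

theory Defs
  imports
    Complex_Main
    "HOL-Library.FuncSet"
    "HOL-Library.Poly_Mapping"
    "Graph_Theory.Digraph_Component"
begin

section \<open>Formal power series in infinitely many variables\<close>

text \<open>
  A monomial is a finitely supported exponent vector \<open>m :: 'v \<Rightarrow>\<^sub>0 nat\<close>, and a formal power series
  in the variables \<open>(x\<^sub>i)\<close>, \<open>i :: 'v\<close>, is an arbitrary family of coefficients indexed by monomials.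
\<close>

typedef ('v, 'a) mps = "UNIV :: (('v \<Rightarrow>\<^sub>0 nat) \<Rightarrow> 'a) set"
  morphisms mps_coeff Abs_mps
  by simp

lemma mps_coeff_Abs [simp]: "mps_coeff (Abs_mps f) = f"
  by (simp add: Abs_mps_inverse)

lemma mps_eqI: "(\<And>m. mps_coeff f m = mps_coeff g m) \<Longrightarrow> f = g"
  by (metis ext mps_coeff_inject)

definition splittings :: "('v \<Rightarrow>\<^sub>0 nat) \<Rightarrow> (('v \<Rightarrow>\<^sub>0 nat) \<times> ('v \<Rightarrow>\<^sub>0 nat)) set" where
  "splittings m = {(a, b). a + b = m}"

lemma finite_splittings [simp]: "finite (splittings (m :: 'v \<Rightarrow>\<^sub>0 nat))"
proof -
  let ?B = "PiE (Poly_Mapping.keys m) (\<lambda>i. {..Poly_Mapping.lookup m i})"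
  let ?r = "\<lambda>a. restrict (Poly_Mapping.lookup a) (Poly_Mapping.keys m)"
  let ?A = "{a. \<exists>b. a + b = m}"
  have sub: "Poly_Mapping.lookup a i = 0" if "a \<in> ?A" "i \<notin> Poly_Mapping.keys m" for a i
    using that by (auto simp: in_keys_iff lookup_add)
  have "inj_on ?r ?A"
  proof (rule inj_onI, rule poly_mapping_eqI)
    fix a b i assume ab: "a \<in> ?A" "b \<in> ?A" "?r a = ?r b"
    show "Poly_Mapping.lookup a i = Poly_Mapping.lookup b i"
    proof (cases "i \<in> Poly_Mapping.keys m")
      case True
      then show ?thesis using fun_cong[OF ab(3), of i] by simp
    next
      case False
      then show ?thesis using sub ab by simp
    qed
  qed
  moreover have "?r ` ?A \<subseteq> ?B"
    by (auto simp: lookup_add)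
  moreover have "finite ?B" by (auto intro: finite_PiE)
  ultimately have fin: "finite ?A" by (intro finite_imageD[of ?r ?A] finite_subset[of "?r ` ?A" ?B])
  have "a \<in> ?A \<and> b \<in> ?A" if "a + b = m" for a b :: "'v \<Rightarrow>\<^sub>0 nat"
    using that add.commute[of a b] by (auto intro: exI[of _ a] exI[of _ b])
  then have "splittings m \<subseteq> ?A \<times> ?A"
    unfolding splittings_def by blast
  then show ?thesis using finite_cartesian_product[OF fin fin] by (rule finite_subset)
qed

instantiation mps :: (type, comm_ring_1) comm_ring_1
begin

definition "0 = Abs_mps (\<lambda>_. 0)"
definition "1 = Abs_mps (\<lambda>m. if m = 0 then 1 else 0)"
definition "f + g = Abs_mps (\<lambda>m. mps_coeff f m + mps_coeff g m)"
definition "f - g = Abs_mps (\<lambda>m. mps_coeff f m - mps_coeff g m)"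
definition "- f = Abs_mps (\<lambda>m. - mps_coeff f m)"
definition "f * g = Abs_mps (\<lambda>m. \<Sum>(a, b)\<in>splittings m. mps_coeff f a * mps_coeff g b)"

instance
proof
  fix f g h :: "('a, 'b) mps"
  note defs = zero_mps_def one_mps_def plus_mps_def minus_mps_def uminus_mps_def times_mps_def
  show "f + g + h = f + (g + h)" "f + g = g + f" "0 + f = f" "- f + f = 0" "f - g = f + - g"
    by (simp_all add: defs mps_coeff_inverse algebra_simps)
  show "f * g = g * f"
    by (rule mps_eqI, simp add: defs,
        rule sum.reindex_bij_witness[where i = prod.swap and j = prod.swap])
       (auto simp: splittings_def algebra_simps)
  show "(f + g) * h = f * h + g * h"
    by (rule mps_eqI) (simp add: defs algebra_simps case_prod_unfold sum.distrib)
  show "1 * f = f"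
  proof (rule mps_eqI)
    fix m :: "'a \<Rightarrow>\<^sub>0 nat"
    have "mps_coeff (1 * f) m =
        (\<Sum>p\<in>splittings m. (if fst p = 0 then 1 else 0) * mps_coeff f (snd p))"
      by (simp add: defs case_prod_unfold)
    also have "\<dots> = (\<Sum>p\<in>{(0 :: 'a \<Rightarrow>\<^sub>0 nat, m)}.
        (if fst p = 0 then 1 else 0) * mps_coeff f (snd p))"
      using finite_splittings by (rule sum.mono_neutral_right) (auto simp: splittings_def)
    finally show "mps_coeff (1 * f) m = mps_coeff f m" by simp
  qed
  show "f * g * h = f * (g * h)"
  proof (rule mps_eqI)
    fix m :: "'a \<Rightarrow>\<^sub>0 nat"
    have "mps_coeff (f * g * h) m = (\<Sum>p\<in>splittings m. \<Sum>q\<in>splittings (fst p).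
        mps_coeff f (fst q) * mps_coeff g (snd q) * mps_coeff h (snd p))"
      by (simp add: defs case_prod_unfold sum_distrib_right)
    also have "\<dots> = (\<Sum>(p, q)\<in>(SIGMA p:splittings m. splittings (fst p)).
        mps_coeff f (fst q) * mps_coeff g (snd q) * mps_coeff h (snd p))"
      by (rule sum.Sigma) auto
    also have "\<dots> = (\<Sum>(p, q)\<in>(SIGMA p:splittings m. splittings (snd p)).
        mps_coeff f (fst p) * (mps_coeff g (fst q) * mps_coeff h (snd q)))"
      by (rule sum.reindex_bij_witness[where
            j = "\<lambda>(p, q). ((fst q, snd q + snd p), (snd q, snd p))" and
            i = "\<lambda>(p, q). ((fst p + fst q, snd q), (fst p, fst q))"])
         (auto simp: splittings_def algebra_simps)
    also have "\<dots> = (\<Sum>p\<in>splittings m. \<Sum>q\<in>splittings (snd p).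
        mps_coeff f (fst p) * (mps_coeff g (fst q) * mps_coeff h (snd q)))"
      by (rule sum.Sigma[symmetric]) auto
    also have "\<dots> = mps_coeff (f * (g * h)) m"
      by (simp add: defs case_prod_unfold sum_distrib_left)
    finally show "mps_coeff (f * g * h) m = mps_coeff (f * (g * h)) m" .
  qed
  show "(0 :: ('a, 'b) mps) \<noteq> 1"
  proof
    assume "(0 :: ('a, 'b) mps) = 1"
    then have "mps_coeff (0 :: ('a, 'b) mps) 0 = mps_coeff 1 0" by simp
    then show False by (simp add: defs)
  qed
qed

end

definition mps_scale :: "'a::comm_ring_1 \<Rightarrow> ('v, 'a) mps \<Rightarrow> ('v, 'a) mps" where
  "mps_scale c f = Abs_mps (\<lambda>m. c * mps_coeff f m)"

global_interpretation mps: vector_space "mps_scale :: 'a::field \<Rightarrow> ('v, 'a) mps \<Rightarrow> ('v, 'a) mps"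
  by unfold_locales
     (auto simp: mps_scale_def plus_mps_def mps_coeff_inverse algebra_simps)


section \<open>The algebra of symmetric functions\<close>

text \<open>
  The variables are indexed by \<open>nat\<close>: the series variable of index \<open>i\<close> plays the role of \<open>x\<^bsub>i+1\<^esub>\<close>.
\<close>

type_synonym power_series = "(nat, rat) mps"

definition total_degree :: "('v \<Rightarrow>\<^sub>0 nat) \<Rightarrow> nat" where
  "total_degree m = (\<Sum>i\<in>Poly_Mapping.keys m. Poly_Mapping.lookup m i)"

definition symmetric_series :: "power_series \<Rightarrow> bool" where
  "symmetric_series f \<longleftrightarrow>
     (\<forall>\<sigma> m. bij \<sigma> \<longrightarrow> mps_coeff f (Poly_Mapping.map_key \<sigma> m) = mps_coeff f m)"

definition homogeneous_series :: "nat \<Rightarrow> power_series \<Rightarrow> bool" where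
  "homogeneous_series n f \<longleftrightarrow> (\<forall>m. mps_coeff f m \<noteq> 0 \<longrightarrow> total_degree m = n)"

definition Sym_homog :: "nat \<Rightarrow> power_series set" where
  "Sym_homog n = {f. symmetric_series f \<and> homogeneous_series n f}"

text \<open>
  The sum of the subspaces \<open>Sym_homog n\<close>; it is direct because a series has at most one
  decomposition into homogeneous parts.
\<close>

definition Sym :: "power_series set" where
  "Sym = mps.span (\<Union>n. Sym_homog n)"


section \<open>Bases and free generation\<close>

definition is_partition :: "nat list \<Rightarrow> bool" where
  "is_partition \<mu> \<longleftrightarrow> sorted_wrt (\<ge>) \<mu> \<and> (\<forall>k\<in>set \<mu>. k > 0)"

definition partitions_of :: "nat \<Rightarrow> nat list set" where
  "partitions_of n = {\<mu>. is_partition \<mu> \<and> sum_list \<mu> = n}"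

definition is_basis_family :: "('i \<Rightarrow> power_series) \<Rightarrow> 'i set \<Rightarrow> power_series set \<Rightarrow> bool" where
  "is_basis_family b I V \<longleftrightarrow> inj_on b I \<and> mps.independent (b ` I) \<and> mps.span (b ` I) = V"

definition multiplicative_basis :: "(nat list \<Rightarrow> power_series) \<Rightarrow> bool" where
  "multiplicative_basis b \<longleftrightarrow>
     is_basis_family b {\<mu>. is_partition \<mu>} Sym \<and>
     (\<forall>n. Sym_homog n = mps.span (b ` partitions_of n)) \<and>
     (\<forall>\<mu>. is_partition \<mu> \<longrightarrow> b \<mu> = (\<Prod>k\<leftarrow>\<mu>. b [k]))"

text \<open>
  The type \<open>('i \<Rightarrow>\<^sub>0 nat) \<Rightarrow>\<^sub>0 rat\<close> is the ring of polynomials over the rationals in commuting variables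
  indexed by \<open>'i\<close>, and \<open>poly_subst b\<close> substitutes \<open>b i\<close> for the variable of index \<open>i\<close>.
\<close>

definition poly_subst :: "('i \<Rightarrow> power_series) \<Rightarrow> (('i \<Rightarrow>\<^sub>0 nat) \<Rightarrow>\<^sub>0 rat) \<Rightarrow> power_series" where
  "poly_subst b P =
     (\<Sum>m\<in>Poly_Mapping.keys P.
        mps_scale (Poly_Mapping.lookup P m) (\<Prod>i\<in>Poly_Mapping.keys m. b i ^ Poly_Mapping.lookup m i))"

definition polys_in :: "'i set \<Rightarrow> (('i \<Rightarrow>\<^sub>0 nat) \<Rightarrow>\<^sub>0 rat) set" where
  "polys_in I = {P. \<forall>m\<in>Poly_Mapping.keys P. Poly_Mapping.keys m \<subseteq> I}"

definition alg_independent :: "('i \<Rightarrow> power_series) \<Rightarrow> 'i set \<Rightarrow> bool" where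
  "alg_independent b I \<longleftrightarrow> (\<forall>P\<in>polys_in I. poly_subst b P = 0 \<longrightarrow> P = 0)"

definition is_subalgebra :: "power_series set \<Rightarrow> bool" where
  "is_subalgebra A \<longleftrightarrow> mps.subspace A \<and> 1 \<in> A \<and> (\<forall>f\<in>A. \<forall>g\<in>A. f * g \<in> A)"

definition generated_subalgebra :: "power_series set \<Rightarrow> power_series set" where
  "generated_subalgebra S = is_subalgebra hull S"

definition freely_generates :: "('i \<Rightarrow> power_series) \<Rightarrow> 'i set \<Rightarrow> power_series set \<Rightarrow> bool" where
  "freely_generates b I A \<longleftrightarrow> alg_independent b I \<and> generated_subalgebra (b ` I) = A"


section \<open>Weighted graphs and extended chromatic symmetric functions\<close>

text \<open>
  An undirected graph is a symmetric digraph: \<^locale>\<open>pseudo_graph\<close> is the class of finite undirected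
  graphs with loops and multiple edges allowed, \<^locale>\<open>graph\<close> that of finite simple graphs.
\<close>

definition weighted_graph :: "('a, 'b) pre_digraph \<Rightarrow> ('a \<Rightarrow> nat) \<Rightarrow> bool" where
  "weighted_graph G w \<longleftrightarrow> pseudo_graph G \<and> (\<forall>v\<in>verts G. w v > 0)"

text \<open>
  Like the variables, the colours are indexed from \<open>0\<close>. Colourings are functions on the vertex set,
  that is, they are \<open>undefined\<close> outside of it.
\<close>

definition proper_colourings :: "('a, 'b) pre_digraph \<Rightarrow> ('a \<Rightarrow> nat) set" where
  "proper_colourings G =
     {\<kappa> \<in> verts G \<rightarrow>\<^sub>E UNIV. \<forall>e\<in>arcs G. \<kappa> (tail G e) \<noteq> \<kappa> (head G e)}"

definition colouring_monomial ::
    "('a, 'b) pre_digraph \<Rightarrow> ('a \<Rightarrow> nat) \<Rightarrow> ('a \<Rightarrow> nat) \<Rightarrow> (nat \<Rightarrow>\<^sub>0 nat)" where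
  "colouring_monomial G w \<kappa> = (\<Sum>v\<in>verts G. Poly_Mapping.single (\<kappa> v) (w v))"

text \<open>
  The sum over all proper colourings is a formal, infinite one: the coefficient of a monomial is the
  number of proper colourings that contribute this monomial, which is finite for a weighted graph.
\<close>

definition chromatic_sf :: "('a, 'b) pre_digraph \<Rightarrow> ('a \<Rightarrow> nat) \<Rightarrow> power_series" where
  "chromatic_sf G w =
     Abs_mps (\<lambda>m. of_nat (card {\<kappa> \<in> proper_colourings G. colouring_monomial G w \<kappa> = m}))"

lemma finite_colourings_of_monomial:
  assumes "weighted_graph G w"
  shows "finite {\<kappa> \<in> proper_colourings G. colouring_monomial G w \<kappa> = m}"
proof -
  interpret pseudo_graph G using assms by (simp add: weighted_graph_def)
  have "\<kappa> v \<in> Poly_Mapping.keys m"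
    if "colouring_monomial G w \<kappa> = m" "v \<in> verts G" for \<kappa> v
  proof -
    have "w v \<le> (\<Sum>u\<in>verts G. Poly_Mapping.lookup (Poly_Mapping.single (\<kappa> u) (w u)) (\<kappa> v))"
      using that(2) finite_verts member_le_sum[of v "verts G"
          "\<lambda>u. Poly_Mapping.lookup (Poly_Mapping.single (\<kappa> u) (w u)) (\<kappa> v)"] by simp
    also have "\<dots> = Poly_Mapping.lookup m (\<kappa> v)"
      using that(1) by (auto simp: colouring_monomial_def lookup_sum)
    finally show ?thesis
      using assms that(2) by (force simp: weighted_graph_def in_keys_iff)
  qed
  then have "{\<kappa> \<in> proper_colourings G. colouring_monomial G w \<kappa> = m} \<subseteq> verts G \<rightarrow>\<^sub>E Poly_Mapping.keys m"
    by (auto simp: proper_colourings_def PiE_iff extensional_def)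
  then show ?thesis
    by (rule finite_subset) (auto intro: finite_PiE)
qed

definition nifty :: "(nat \<Rightarrow> ('a, 'b) pre_digraph) \<Rightarrow> (nat \<Rightarrow> 'a \<Rightarrow> nat) \<Rightarrow> bool" where
  "nifty G w \<longleftrightarrow> (\<forall>n\<ge>1. weighted_graph (G n) (w n) \<and> graph (G n) \<and>
     Digraph_Component.connected (G n) \<and> (\<Sum>v\<in>verts (G n). w n v) = n)"

text \<open>
  The disjoint union over the parts of a partition; vertices and arcs are tagged by the position of
  the part, so that equal parts contribute distinct copies.
\<close>

definition union_graph ::
    "(nat \<Rightarrow> ('a, 'b) pre_digraph) \<Rightarrow> nat list \<Rightarrow> (nat \<times> 'a, nat \<times> 'b) pre_digraph" where
  "union_graph G \<mu> =
     \<lparr> verts = (SIGMA i:{..<length \<mu>}. verts (G (\<mu> ! i))),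
       arcs = (SIGMA i:{..<length \<mu>}. arcs (G (\<mu> ! i))),
       tail = (\<lambda>(i, e). (i, tail (G (\<mu> ! i)) e)),
       head = (\<lambda>(i, e). (i, head (G (\<mu> ! i)) e)) \<rparr>"

definition union_weight :: "(nat \<Rightarrow> 'a \<Rightarrow> nat) \<Rightarrow> nat list \<Rightarrow> nat \<times> 'a \<Rightarrow> nat" where
  "union_weight w \<mu> = (\<lambda>(i, v). w (\<mu> ! i) v)"

end

theory Submission
  imports Defs "HOL-Combinatorics.Permutations" "HOL-Library.Multiset"
begin

text \<open>
  Deletion and contraction of an edge \<open>e\<close> give \<open>X\<^bsub>G\<^esub> = X\<^bsub>G - e\<^esub> - X\<^bsub>G/e\<^esub>\<close>, where the weight of the
  contracted vertex is the sum of the weights of the two ends of \<open>e\<close>. By induction on the edges,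
  \<open>X\<^bsub>G\<^esub>\<close> is a combination of products of power sums in which the coefficient of \<open>p\<^bsub>n\<^esub>\<close>, \<open>n\<close> being the
  total weight, is \<open>(-1)\<^bsup>N - 1\<^esup>\<close> times a nonnegative number for \<open>N\<close> vertices, and is nonzero if
  \<open>G\<close> is connected. Applied to complete graphs, this shows that the products of power sums span
  \<open>Sym\<close>. Applied to a nifty family, it expresses \<open>p\<^bsub>n\<^esub>\<close> by \<open>X\<^bsub>G n\<^esub>\<close> and products of smaller power
  sums, so the products of the \<open>X\<^bsub>G n\<^esub>\<close> span \<open>Sym\<close> too. In degree \<open>n\<close> there are as many such
  products as partitions of \<open>n\<close>, which is the dimension, so they form a basis.
\<close>

section \<open>Arithmetic of power series\<close>

lemma mps_coeff_zero [simp]: "mps_coeff 0 m = 0"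
  by (simp add: zero_mps_def)

lemma mps_coeff_one: "mps_coeff 1 m = (if m = 0 then 1 else 0)"
  by (simp add: one_mps_def)

lemma mps_coeff_add [simp]: "mps_coeff (f + g) m = mps_coeff f m + mps_coeff g m"
  by (simp add: plus_mps_def)

lemma mps_coeff_diff [simp]: "mps_coeff (f - g) m = mps_coeff f m - mps_coeff g m"
  by (simp add: minus_mps_def)

lemma mps_coeff_scale [simp]: "mps_coeff (mps_scale c f) m = c * mps_coeff f m"
  by (simp add: mps_scale_def)

lemma mps_coeff_mult:
  "mps_coeff (f * g) m = (\<Sum>(a, b)\<in>splittings m. mps_coeff f a * mps_coeff g b)"
  by (simp add: times_mps_def)

lemma mps_coeff_sum [simp]: "mps_coeff (sum f A) m = (\<Sum>a\<in>A. mps_coeff (f a) m)"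
  by (induction A rule: infinite_finite_induct) auto

lemma mps_scale_mult_left: "mps_scale c f * g = mps_scale c (f * g)"
  by (rule mps_eqI) (simp add: mps_coeff_mult sum_distrib_left case_prod_unfold mult.assoc)

lemma mps_scale_mult_right: "f * mps_scale c g = mps_scale c (f * g)"
  by (metis mps_scale_mult_left mult.commute)

text \<open>By bilinearity it suffices to check products of generators: the second factor is
  extended to its span for each fixed \<open>a\<close>, then the first.\<close>

lemma mps_span_mult:
  fixes f g :: "('v, 'a::field) mps"
  assumes "\<And>a b. a \<in> A \<Longrightarrow> b \<in> B \<Longrightarrow> a * b \<in> mps.span C"
    and f: "f \<in> mps.span A" and g: "g \<in> mps.span B"
  shows "f * g \<in> mps.span C"
proof -
  have "mps.span B \<subseteq> {g. a * g \<in> mps.span C}" if "a \<in> A" for a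
    using assms(1)[OF that]
    by (intro mps.span_minimal)
       (auto simp: mps.subspace_def distrib_left mps_scale_mult_right mps.span_zero
          intro: mps.span_add mps.span_scale)
  then have "mps.span A \<subseteq> {f. \<forall>g\<in>mps.span B. f * g \<in> mps.span C}"
    by (intro mps.span_minimal)
       (auto simp: mps.subspace_def distrib_right mps_scale_mult_left mps.span_zero
          intro: mps.span_add mps.span_scale)
  with f g show ?thesis by blast
qed

section \<open>Weighted enumeration\<close>

text \<open>Since \<open>card\<close> of an infinite set is 0, \<open>genfun\<close> counts
  faithfully only when every fibre is finite; the sum and product rules rely on this.\<close>

definition finite_fibres :: "'s set \<Rightarrow> ('s \<Rightarrow> 'm) \<Rightarrow> bool" where
  "finite_fibres S wt \<longleftrightarrow> (\<forall>m. finite {s \<in> S. wt s = m})"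

lemma finite_fibres_subset:
  assumes "finite_fibres T wt" "S \<subseteq> T"
  shows "finite_fibres S wt"
  unfolding finite_fibres_def
proof
  fix m
  show "finite {s \<in> S. wt s = m}"
    by (rule finite_subset[of _ "{s \<in> T. wt s = m}"])
       (use assms in \<open>auto simp: finite_fibres_def\<close>)
qed

definition genfun :: "'s set \<Rightarrow> ('s \<Rightarrow> (nat \<Rightarrow>\<^sub>0 nat)) \<Rightarrow> power_series" where
  "genfun S wt = Abs_mps (\<lambda>m. of_nat (card {s \<in> S. wt s = m}))"

lemma mps_coeff_genfun: "mps_coeff (genfun S wt) m = of_nat (card {s \<in> S. wt s = m})"
  by (simp add: genfun_def)

lemma genfun_reindex:
  assumes "bij_betw h S T" and wt: "\<And>s. s \<in> S \<Longrightarrow> wt' (h s) = wt s"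
  shows "genfun S wt = genfun T wt'"
proof (rule mps_eqI)
  fix m
  have "bij_betw h {s \<in> S. wt s = m} {t \<in> T. wt' t = m}"
    using assms(1) by (auto simp: bij_betw_def inj_on_def image_iff wt)
  then show "mps_coeff (genfun S wt) m = mps_coeff (genfun T wt') m"
    by (simp add: mps_coeff_genfun bij_betw_same_card)
qed

lemma genfun_Un:
  assumes "finite_fibres S wt" "finite_fibres T wt" "S \<inter> T = {}"
  shows "genfun (S \<union> T) wt = genfun S wt + genfun T wt"
proof (rule mps_eqI)
  fix m
  have "{s \<in> S \<union> T. wt s = m} = {s \<in> S. wt s = m} \<union> {s \<in> T. wt s = m}" by auto
  moreover have "card ({s \<in> S. wt s = m} \<union> {s \<in> T. wt s = m}) =
      card {s \<in> S. wt s = m} + card {s \<in> T. wt s = m}"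
    using assms by (intro card_Un_disjoint) (auto simp: finite_fibres_def)
  ultimately show "mps_coeff (genfun (S \<union> T) wt) m = mps_coeff (genfun S wt + genfun T wt) m"
    by (simp add: mps_coeff_genfun)
qed

text \<open>Pairs of total weight \<open>m\<close> are sorted by the splitting of \<open>m\<close>
  formed by their two weights, which is the convolution defining the product of series.\<close>

lemma genfun_times:
  assumes "finite_fibres S wt" "finite_fibres T wt'"
  shows "genfun (S \<times> T) (\<lambda>(s, t). wt s + wt' t) = genfun S wt * genfun T wt'"
proof (rule mps_eqI)
  fix m
  let ?F = "\<lambda>(a, b). {s \<in> S. wt s = a} \<times> {t \<in> T. wt' t = b}"
  have "{p \<in> S \<times> T. (\<lambda>(s, t). wt s + wt' t) p = m} = (\<Union>p\<in>splittings m. ?F p)"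
    by (auto simp: splittings_def)
  also have "card \<dots> = (\<Sum>p\<in>splittings m. card (?F p))"
    using assms by (intro card_UN_disjoint) (auto simp: finite_fibres_def)
  finally show "mps_coeff (genfun (S \<times> T) (\<lambda>(s, t). wt s + wt' t)) m =
      mps_coeff (genfun S wt * genfun T wt') m"
    by (simp add: mps_coeff_genfun mps_coeff_mult card_cartesian_product case_prod_unfold)
qed

section \<open>Total degree of monomials\<close>

lemma total_degree_superset:
  assumes "finite A" "Poly_Mapping.keys m \<subseteq> A"
  shows "total_degree m = (\<Sum>i\<in>A. Poly_Mapping.lookup m i)"
  unfolding total_degree_def using assms
  by (intro sum.mono_neutral_left) (auto simp: in_keys_iff)

lemma total_degree_add: "total_degree (a + b) = total_degree a + total_degree b"
proof -
  let ?A = "Poly_Mapping.keys a \<union> Poly_Mapping.keys b"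
  have "Poly_Mapping.keys (a + b) \<subseteq> ?A" by (rule keys_add)
  then show ?thesis
    using total_degree_superset[of ?A "a + b"] total_degree_superset[of ?A a]
      total_degree_superset[of ?A b]
    by (simp add: lookup_add sum.distrib)
qed

lemma total_degree_zero [simp]: "total_degree 0 = 0"
  by (simp add: total_degree_def)

lemma total_degree_single [simp]: "total_degree (Poly_Mapping.single i k) = k"
  by (simp add: total_degree_def)

lemma total_degree_sum: "total_degree (\<Sum>a\<in>A. f a) = (\<Sum>a\<in>A. total_degree (f a))"
  by (induction A rule: infinite_finite_induct) (auto simp: total_degree_add)

section \<open>Colourings of a symmetric relation\<close>

text \<open>Properness depends only on which vertices are adjacent. A bare vertex set with a
  relation lets edges be deleted and vertices merged directly, and parallel edges created by a merge
  coincide.\<close>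

definition colourings :: "'a set \<Rightarrow> ('a \<times> 'a) set \<Rightarrow> ('a \<Rightarrow> nat) set" where
  "colourings V E = {\<kappa> \<in> V \<rightarrow>\<^sub>E UNIV. \<forall>(u, v)\<in>E. \<kappa> u \<noteq> \<kappa> v}"

lemma colouringsI:
  assumes "\<kappa> \<in> V \<rightarrow>\<^sub>E UNIV" "\<And>u v. (u, v) \<in> E \<Longrightarrow> \<kappa> u \<noteq> \<kappa> v"
  shows "\<kappa> \<in> colourings V E"
  using assms by (auto simp: colourings_def)

lemma colouringsD: "\<kappa> \<in> colourings V E \<Longrightarrow> (u, v) \<in> E \<Longrightarrow> \<kappa> u \<noteq> \<kappa> v"
  by (auto simp: colourings_def)

definition colour_mono :: "'a set \<Rightarrow> ('a \<Rightarrow> nat) \<Rightarrow> ('a \<Rightarrow> nat) \<Rightarrow> (nat \<Rightarrow>\<^sub>0 nat)" where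
  "colour_mono V w \<kappa> = (\<Sum>v\<in>V. Poly_Mapping.single (\<kappa> v) (w v))"

definition csf :: "'a set \<Rightarrow> ('a \<Rightarrow> nat) \<Rightarrow> ('a \<times> 'a) set \<Rightarrow> power_series" where
  "csf V w E = genfun (colourings V E) (colour_mono V w)"

lemma chromatic_sf_eq_csf: "chromatic_sf G w = csf (verts G) w (arcs_ends G)"
proof -
  have "proper_colourings G = colourings (verts G) (arcs_ends G)"
    by (simp add: proper_colourings_def colourings_def arcs_ends_conv)
  moreover have "colouring_monomial G w = colour_mono (verts G) w"
    by (simp add: fun_eq_iff colouring_monomial_def colour_mono_def)
  ultimately show ?thesis by (simp add: chromatic_sf_def csf_def genfun_def)
qed

lemma lookup_colour_mono:
  "Poly_Mapping.lookup (colour_mono V w \<kappa>) i = (\<Sum>v\<in>V. if \<kappa> v = i then w v else 0)"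
  by (simp add: colour_mono_def lookup_sum lookup_single when_def)

lemma total_degree_colour_mono [simp]: "total_degree (colour_mono V w \<kappa>) = sum w V"
  by (simp add: colour_mono_def total_degree_sum)

text \<open>Weights are positive and exponents cannot cancel, so a monomial records every colour
  used.\<close>

lemma keys_colour_mono:
  assumes "finite V" "\<And>v. v \<in> V \<Longrightarrow> w v > 0"
  shows "Poly_Mapping.keys (colour_mono V w \<kappa>) = \<kappa> ` V"
proof -
  have "(\<Sum>v\<in>V. if \<kappa> v = i then w v else 0) = 0 \<longleftrightarrow> i \<notin> \<kappa> ` V" for i
    using assms by (auto simp: sum_eq_0_iff split: if_splits) (metis less_numeral_extra(3))
  then show ?thesis by (auto simp: in_keys_iff lookup_colour_mono)
qed

text \<open>The colours of a colouring lie among the variables of its monomial, so each fibre lies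
  in a finite function space.\<close>

lemma finite_fibres_colourings:
  assumes "finite V" "\<And>v. v \<in> V \<Longrightarrow> w v > 0"
  shows "finite_fibres (colourings V E) (colour_mono V w)"
  unfolding finite_fibres_def
proof
  fix m
  have "{\<kappa> \<in> colourings V E. colour_mono V w \<kappa> = m} \<subseteq> V \<rightarrow>\<^sub>E Poly_Mapping.keys m"
    using keys_colour_mono[OF assms] by (auto simp: colourings_def PiE_def Pi_def)
  then show "finite {\<kappa> \<in> colourings V E. colour_mono V w \<kappa> = m}"
    by (rule finite_subset) (use assms in \<open>auto intro: finite_PiE\<close>)
qed

text \<open>\<open>map_key \<sigma>\<close> moves the exponent found at \<open>\<sigma> i\<close> to
  \<open>i\<close>, so permuting variables amounts to recolouring by the inverse.\<close>

lemma map_key_colour_mono: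
  assumes "bij \<sigma>"
  shows "Poly_Mapping.map_key \<sigma> (colour_mono V w \<kappa>) = colour_mono V w (restrict (inv \<sigma> \<circ> \<kappa>) V)"
proof (rule poly_mapping_eqI)
  fix i
  have "(\<kappa> v = \<sigma> i) = (inv \<sigma> (\<kappa> v) = i)" for v
    using assms by (metis bij_inv_eq_iff)
  then show "Poly_Mapping.lookup (Poly_Mapping.map_key \<sigma> (colour_mono V w \<kappa>)) i =
      Poly_Mapping.lookup (colour_mono V w (restrict (inv \<sigma> \<circ> \<kappa>) V)) i"
    using assms by (auto simp: map_key.rep_eq bij_is_inj lookup_colour_mono intro!: sum.cong)
qed

text \<open>Every monomial has the total weight as its degree. Renaming colours by a bijection
  preserves properness, so it matches the fibre over \<open>m\<close> with the one over
  \<open>Poly_Mapping.map_key \<sigma> m\<close>.\<close>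

lemma csf_in_Sym_homog:
  assumes "E \<subseteq> V \<times> V"
  shows "csf V w E \<in> Sym_homog (sum w V)"
proof -
  have "homogeneous_series (sum w V) (csf V w E)"
    unfolding homogeneous_series_def csf_def mps_coeff_genfun
    by (metis (mono_tags, lifting) card.empty empty_Collect_eq of_nat_0 total_degree_colour_mono)
  moreover have "symmetric_series (csf V w E)"
    unfolding symmetric_series_def
  proof (intro allI impI)
    fix \<sigma> :: "nat \<Rightarrow> nat" and m
    assume \<sigma>: "bij \<sigma>"
    let ?f = "\<lambda>\<tau> \<kappa>. restrict (\<tau> \<circ> \<kappa>) V"
    have inv: "inv \<sigma> (\<sigma> x) = x" "\<sigma> (inv \<sigma> x) = x" for x
      using \<sigma> by (simp_all add: bij_is_inj bij_is_surj surj_f_inv_f)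
    have inv_inv: "inv (inv \<sigma>) = \<sigma>" using \<sigma> by (simp add: inv_inv_eq)
    have col: "?f \<tau> \<kappa> \<in> colourings V E" if "bij \<tau>" "\<kappa> \<in> colourings V E" for \<tau> \<kappa>
      using that assms by (auto simp: colourings_def bij_is_inj inj_eq split: if_splits; blast)
    have "bij_betw (?f (inv \<sigma>)) {\<kappa> \<in> colourings V E. colour_mono V w \<kappa> = m}
        {\<kappa> \<in> colourings V E. colour_mono V w \<kappa> = Poly_Mapping.map_key \<sigma> m}"
    proof (rule bij_betw_byWitness[where f' = "?f \<sigma>"])
      show "\<forall>\<kappa>\<in>{\<kappa> \<in> colourings V E. colour_mono V w \<kappa> = m}. ?f \<sigma> (?f (inv \<sigma>) \<kappa>) = \<kappa>"
        "\<forall>\<kappa>\<in>{\<kappa> \<in> colourings V E. colour_mono V w \<kappa> = Poly_Mapping.map_key \<sigma> m}.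
          ?f (inv \<sigma>) (?f \<sigma> \<kappa>) = \<kappa>"
        by (auto simp: colourings_def inv PiE_iff extensional_def fun_eq_iff)
      show "?f (inv \<sigma>) ` {\<kappa> \<in> colourings V E. colour_mono V w \<kappa> = m}
          \<subseteq> {\<kappa> \<in> colourings V E. colour_mono V w \<kappa> = Poly_Mapping.map_key \<sigma> m}"
        using \<sigma> col[of "inv \<sigma>"] by (auto simp: map_key_colour_mono bij_imp_bij_inv)
      show "?f \<sigma> ` {\<kappa> \<in> colourings V E. colour_mono V w \<kappa> = Poly_Mapping.map_key \<sigma> m}
          \<subseteq> {\<kappa> \<in> colourings V E. colour_mono V w \<kappa> = m}"
      proof safe
        fix \<kappa> assume \<kappa>: "\<kappa> \<in> colourings V E" "colour_mono V w \<kappa> = Poly_Mapping.map_key \<sigma> m"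
        show "?f \<sigma> \<kappa> \<in> colourings V E" using col \<sigma> \<kappa> by blast
        have "colour_mono V w (?f \<sigma> \<kappa>) = Poly_Mapping.map_key (inv \<sigma>) (colour_mono V w \<kappa>)"
          using \<sigma> map_key_colour_mono[of "inv \<sigma>" V w \<kappa>] by (simp add: bij_imp_bij_inv inv_inv)
        also have "\<dots> = m"
          unfolding \<kappa>(2)
          by (rule poly_mapping_eqI) (use \<sigma> in \<open>simp add: map_key.rep_eq bij_is_inj bij_imp_bij_inv inv\<close>)
        finally show "colour_mono V w (?f \<sigma> \<kappa>) = m" .
      qed
    qed
    then show "mps_coeff (csf V w E) (Poly_Mapping.map_key \<sigma> m) = mps_coeff (csf V w E) m"
      by (simp add: csf_def mps_coeff_genfun bij_betw_same_card)
  qed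
  ultimately show ?thesis by (simp add: Sym_homog_def)
qed

section \<open>Disjoint unions, relabelling, deletion and contraction\<close>

text \<open>No edge joins the two sides, so a proper colouring is exactly a pair of proper
  colourings, and the monomials multiply.\<close>

lemma csf_disjoint_Un:
  assumes fin: "finite V" "finite V'" and pos: "\<And>v. v \<in> V \<union> V' \<Longrightarrow> w v > 0"
    and disj: "V \<inter> V' = {}" and sub: "E \<subseteq> V \<times> V" "E' \<subseteq> V' \<times> V'"
  shows "csf (V \<union> V') w (E \<union> E') = csf V w E * csf V' w E'"
proof -
  let ?h = "\<lambda>\<kappa>. (restrict \<kappa> V, restrict \<kappa> V')"
  let ?g = "\<lambda>(\<kappa>, \<kappa>'). restrict (\<lambda>x. if x \<in> V then \<kappa> x else \<kappa>' x) (V \<union> V')"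
  have "bij_betw ?h (colourings (V \<union> V') (E \<union> E')) (colourings V E \<times> colourings V' E')"
  proof (rule bij_betw_byWitness[where f' = ?g])
    show "\<forall>\<kappa>\<in>colourings (V \<union> V') (E \<union> E'). ?g (?h \<kappa>) = \<kappa>"
      by (auto simp: colourings_def PiE_iff extensional_def fun_eq_iff)
    show "\<forall>p\<in>colourings V E \<times> colourings V' E'. ?h (?g p) = p"
      using disj by (auto simp: colourings_def PiE_iff extensional_def fun_eq_iff)
    have E: "x \<in> V \<and> y \<in> V" if "(x, y) \<in> E" for x y using that sub by auto
    have E': "x \<in> V' - V \<and> y \<in> V' - V" if "(x, y) \<in> E'" for x y using that sub disj by auto
    show "?h ` colourings (V \<union> V') (E \<union> E') \<subseteq> colourings V E \<times> colourings V' E'"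
      using E E' by (auto intro!: colouringsI dest: colouringsD)
    show "?g ` (colourings V E \<times> colourings V' E') \<subseteq> colourings (V \<union> V') (E \<union> E')"
      using E E' by (auto intro!: colouringsI dest: colouringsD)
  qed
  moreover have "(\<lambda>(s, t). colour_mono V w s + colour_mono V' w t) (?h \<kappa>) = colour_mono (V \<union> V') w \<kappa>" for \<kappa>
    using fin disj by (simp add: colour_mono_def sum.union_disjoint)
  ultimately have "csf (V \<union> V') w (E \<union> E') = genfun (colourings V E \<times> colourings V' E')
      (\<lambda>(s, t). colour_mono V w s + colour_mono V' w t)"
    unfolding csf_def by (rule genfun_reindex)
  also have "\<dots> = csf V w E * csf V' w E'"
    unfolding csf_def using assms by (intro genfun_times finite_fibres_colourings) auto
  finally show ?thesis .
qed

lemma csf_image: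
  assumes inj: "inj_on f V" and sub: "E \<subseteq> V \<times> V"
  shows "csf (f ` V) w (map_prod f f ` E) = csf V (w \<circ> f) E"
proof -
  let ?h = "\<lambda>\<kappa>. restrict (\<kappa> \<circ> f) V"
  let ?g = "\<lambda>\<kappa>. restrict (\<kappa> \<circ> inv_into V f) (f ` V)"
  have "bij_betw ?h (colourings (f ` V) (map_prod f f ` E)) (colourings V E)"
  proof (rule bij_betw_byWitness[where f' = ?g])
    show "\<forall>\<kappa>\<in>colourings (f ` V) (map_prod f f ` E). ?g (?h \<kappa>) = \<kappa>"
      using inj by (auto simp: colourings_def PiE_iff extensional_def fun_eq_iff)
    show "\<forall>\<kappa>\<in>colourings V E. ?h (?g \<kappa>) = \<kappa>"
      using inj by (auto simp: colourings_def PiE_iff extensional_def fun_eq_iff)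
    show "?h ` colourings (f ` V) (map_prod f f ` E) \<subseteq> colourings V E"
      using sub by (fastforce simp: colourings_def)
    have "?g \<kappa> \<in> colourings (f ` V) (map_prod f f ` E)" if "\<kappa> \<in> colourings V E" for \<kappa>
    proof -
      have g: "?g \<kappa> (f v) = \<kappa> v" if "v \<in> V" for v using that inj by simp
      have col: "\<kappa> u \<noteq> \<kappa> v" "u \<in> V" "v \<in> V" if "(u, v) \<in> E" for u v
        using that sub \<open>\<kappa> \<in> colourings V E\<close> by (auto simp: colourings_def)
      have "?g \<kappa> x \<noteq> ?g \<kappa> y" if xy: "(x, y) \<in> map_prod f f ` E" for x y
      proof -
        obtain a b where ab: "(a, b) \<in> E" "x = f a" "y = f b" using xy by auto
        with g col[OF ab(1)] show ?thesis by metis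
      qed
      moreover have "?g \<kappa> \<in> f ` V \<rightarrow>\<^sub>E UNIV" by auto
      ultimately show ?thesis unfolding colourings_def by blast
    qed
    then show "?g ` colourings V E \<subseteq> colourings (f ` V) (map_prod f f ` E)" by blast
  qed
  moreover have "colour_mono V (w \<circ> f) (?h \<kappa>) = colour_mono (f ` V) w \<kappa>" for \<kappa>
    using inj by (simp add: colour_mono_def sum.reindex)
  ultimately show ?thesis
    unfolding csf_def by (intro genfun_reindex[where h = ?h])
qed

text \<open>Colourings of the graph without the edge are sorted by whether \<open>u\<close> and
  \<open>v\<close> receive different colours. If they do, the edge may be restored; if not,
  \<open>v\<close> is merged into \<open>u\<close>, which then carries both weights. Both
  orientations are removed, so the edge does not become a loop.\<close>

lemma csf_deletion_contraction:
  assumes fin: "finite V" and pos: "\<And>v. v \<in> V \<Longrightarrow> w v > 0" and sub: "E \<subseteq> V \<times> V"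
    and uv: "u \<in> V" "v \<in> V" "u \<noteq> v" "(u, v) \<in> E"
    and E': "E' = E - {(u, v), (v, u)}"
  shows "csf V w E' = csf V w E +
    csf (V - {v}) (w(u := w u + w v)) (map_prod (id(v := u)) (id(v := u)) ` E')"
proof -
  let ?f = "id(v := u)" and ?w = "w(u := w u + w v)"
  let ?S = "{\<kappa> \<in> colourings V E'. \<kappa> u = \<kappa> v}"
  let ?E = "map_prod ?f ?f ` E'"
  have split: "colourings V E' = colourings V E \<union> ?S"
    unfolding E' colourings_def using uv by auto
  have disj: "colourings V E \<inter> ?S = {}"
    using uv by (auto simp: colourings_def)
  have ff: "finite_fibres (colourings V E') (colour_mono V w)"
    using fin pos by (rule finite_fibres_colourings)
  have ff': "finite_fibres (colourings V E) (colour_mono V w)" "finite_fibres ?S (colour_mono V w)"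
    using split by (auto intro: finite_fibres_subset[OF ff])
  have "csf V w E' = csf V w E + genfun ?S (colour_mono V w)"
    unfolding csf_def using genfun_Un[OF ff' disj] split by metis
  also have "genfun ?S (colour_mono V w) = csf (V - {v}) ?w ?E"
    unfolding csf_def
  proof (rule genfun_reindex[where h = "\<lambda>\<kappa>. restrict \<kappa> (V - {v})"])
    let ?h = "\<lambda>\<kappa>. restrict \<kappa> (V - {v})" and ?g = "\<lambda>\<kappa>. restrict (\<kappa> \<circ> ?f) V"
    have sub': "x \<in> V" "y \<in> V" if "(x, y) \<in> E'" for x y using that sub E' by auto
    show "bij_betw ?h ?S (colourings (V - {v}) ?E)"
    proof (rule bij_betw_byWitness[where f' = ?g]; (rule ballI | rule image_subsetI))
      fix \<kappa> assume \<kappa>: "\<kappa> \<in> ?S"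
      then have ext: "\<kappa> x = undefined" if "x \<notin> V" for x
        using that by (auto simp: colourings_def)
      have f: "?h \<kappa> (?f x) = \<kappa> x" if "x \<in> V" for x
        using that \<kappa> uv by auto
      show "?g (?h \<kappa>) = \<kappa>"
      proof
        fix x
        show "?g (?h \<kappa>) x = \<kappa> x"
        proof (cases "x \<in> V")
          case True
          then show ?thesis by (simp only: restrict_apply' comp_apply f)
        next
          case False
          then show ?thesis by (simp add: ext)
        qed
      qed
      have "?h \<kappa> (?f x) \<noteq> ?h \<kappa> (?f y)" if "(x, y) \<in> E'" for x y
      proof -
        have "\<kappa> x \<noteq> \<kappa> y" using \<kappa> that by (auto simp: colourings_def)
        then show ?thesis by (simp only: f sub'[OF that] not_False_eq_True)
      qed
      then have "\<forall>(x, y)\<in>?E. ?h \<kappa> x \<noteq> ?h \<kappa> y"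
        by (auto simp del: restrict_apply fun_upd_apply)
      moreover have "?h \<kappa> \<in> V - {v} \<rightarrow>\<^sub>E UNIV" by auto
      ultimately show "?h \<kappa> \<in> colourings (V - {v}) ?E"
        unfolding colourings_def by blast
    next
      fix \<kappa> assume \<kappa>: "\<kappa> \<in> colourings (V - {v}) ?E"
      then have ext: "\<kappa> x = undefined" if "x \<notin> V - {v}" for x
        using that by (auto simp: colourings_def)
      have f: "?f x = x" if "x \<noteq> v" for x using that by simp
      show "?h (?g \<kappa>) = \<kappa>"
        using ext by (auto simp: restrict_def fun_eq_iff)
      have g: "?g \<kappa> x = \<kappa> (?f x)" if "x \<in> V" for x using that by simp
      have "?g \<kappa> x \<noteq> ?g \<kappa> y" if "(x, y) \<in> E'" for x y
      proof -
        have "(?f x, ?f y) \<in> ?E" using that by force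
        then have "\<kappa> (?f x) \<noteq> \<kappa> (?f y)" using \<kappa> by (rule colouringsD[rotated])
        then show ?thesis using g sub'[OF that] by metis
      qed
      moreover have "?g \<kappa> u = ?g \<kappa> v" using uv by simp
      moreover have "?g \<kappa> \<in> V \<rightarrow>\<^sub>E UNIV" by auto
      ultimately show "?g \<kappa> \<in> ?S" unfolding colourings_def by blast
    qed
    fix \<kappa> assume \<kappa>: "\<kappa> \<in> ?S"
    \<comment> \<open>The terms of \<open>u\<close> and \<open>v\<close> are split off: their
      colours agree, so their weights add up in one exponent.\<close>
    have "colour_mono V w \<kappa> = Poly_Mapping.single (\<kappa> v) (w v) +
        (Poly_Mapping.single (\<kappa> u) (w u) + (\<Sum>x\<in>V - {v} - {u}. Poly_Mapping.single (\<kappa> x) (w x)))"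
      unfolding colour_mono_def using fin uv
      by (subst sum.remove[of V v], simp, simp, subst sum.remove[of "V - {v}" u]) simp_all
    also have "\<dots> = Poly_Mapping.single (\<kappa> u) (?w u) +
        (\<Sum>x\<in>V - {v} - {u}. Poly_Mapping.single (\<kappa> x) (?w x))"
      using \<kappa> by (simp add: single_add ac_simps)
    also have "\<dots> = (\<Sum>x\<in>V - {v}. Poly_Mapping.single (\<kappa> x) (?w x))"
      using fin uv by (intro sum.remove[symmetric]) simp_all
    also have "\<dots> = colour_mono (V - {v}) ?w (?h \<kappa>)"
      unfolding colour_mono_def by (intro sum.cong) auto
    finally show "colour_mono (V - {v}) ?w (?h \<kappa>) = colour_mono V w \<kappa>" ..
  qed
  finally show ?thesis .
qed

section \<open>Expansion into power sums\<close>

text \<open>Partitions of \<open>n\<close> as multisets of parts, which suits a commutative product;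
  \<open>mset_image_partitions_of\<close> links them to decreasing lists.\<close>

definition mpartitions :: "nat \<Rightarrow> nat multiset set" where
  "mpartitions n = {M. 0 \<notin># M \<and> \<Sum>\<^sub># M = n}"

definition mset_mult :: "(nat \<Rightarrow> power_series) \<Rightarrow> nat multiset \<Rightarrow> power_series" where
  "mset_mult x M = (\<Prod>k\<in>#M. x k)"

lemma mset_mult_empty [simp]: "mset_mult x {#} = 1"
  and mset_mult_single [simp]: "mset_mult x {#k#} = x k"
  and mset_mult_add_mset [simp]: "mset_mult x (add_mset k M) = x k * mset_mult x M"
  and mset_mult_union: "mset_mult x (M + N) = mset_mult x M * mset_mult x N"
  by (simp_all add: mset_mult_def)

text \<open>A single vertex may take any colour, which contributes the \<open>n\<close>-th power of
  that variable; for \<open>n > 0\<close> this is the usual power sum. For \<open>n = 0\<close> the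
  only fibre is infinite and the series is 0.\<close>

definition power_sum :: "nat \<Rightarrow> power_series" where
  "power_sum n = csf {()} (\<lambda>_. n) {}"

lemma csf_singleton: "csf {v} w {} = power_sum (w v)"
  using csf_image[of "\<lambda>_. v" "{()}" "{}" w] by (simp add: power_sum_def comp_def)

lemma csf_empty: "csf {} w {} = 1"
proof (rule mps_eqI)
  fix m :: "nat \<Rightarrow>\<^sub>0 nat"
  have "{\<kappa> \<in> colourings {} {}. colour_mono {} w \<kappa> = m} = (if m = 0 then {\<lambda>_. undefined} else {})"
    by (auto simp: colourings_def colour_mono_def)
  then show "mps_coeff (csf {} w {}) m = mps_coeff 1 m"
    by (simp add: csf_def mps_coeff_genfun mps_coeff_one)
qed

lemma csf_edgeless:
  assumes "finite V" "\<And>v. v \<in> V \<Longrightarrow> w v > 0"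
  shows "csf V w {} = mset_mult power_sum (image_mset w (mset_set V))"
  using assms
proof (induction V)
  case empty
  then show ?case by (simp add: csf_empty)
next
  case (insert v V)
  then have "csf ({v} \<union> V) w ({} \<union> {}) = csf {v} w {} * csf V w {}"
    by (intro csf_disjoint_Un) auto
  with insert show ?case by (simp add: csf_singleton)
qed

text \<open>Paths survive a map that sends each edge to an edge or collapses it to a point; this
  carries connectedness over to a contraction.\<close>

lemma rtrancl_map_prod:
  assumes "(a, b) \<in> E\<^sup>*" and "\<And>x y. (x, y) \<in> E \<Longrightarrow> f x = f y \<or> (f x, f y) \<in> E'"
  shows "(f a, f b) \<in> E'\<^sup>*"
  using assms(1)
proof induction
  case (step y z)
  then show ?case using assms(2)[of y z] by (auto intro: rtrancl_into_rtrancl)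
qed simp

text \<open>
  Both sides of \<open>X\<^bsub>G\<^esub> = X\<^bsub>G - e\<^esub> - X\<^bsub>G/e\<^esub>\<close> contribute to the coefficient of the power sum with the
  same sign, since the contraction has one vertex less; and contraction preserves connectedness.
\<close>

lemma csf_power_sum_expansion:
  assumes "finite V" "V \<noteq> {}" "\<And>v. v \<in> V \<Longrightarrow> w v > 0" "E \<subseteq> V \<times> V" "sym E" "irrefl E"
  shows "\<exists>c\<ge>0. (V \<times> V \<subseteq> E\<^sup>* \<longrightarrow> c > 0) \<and>
    csf V w E - mps_scale ((- 1) ^ Suc (card V) * c) (power_sum (sum w V))
      \<in> mps.span (mset_mult power_sum ` {M \<in> mpartitions (sum w V). size M \<ge> 2})"
  using assms
proof (induction "card E" arbitrary: V w E rule: less_induct)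
  case less
  note fin = less.prems(1) and pos = less.prems(3)
  let ?D = "mset_mult power_sum ` {M \<in> mpartitions (sum w V). size M \<ge> 2}"
  have finE: "finite E" using less.prems(1,4) by (auto intro: finite_subset)
  show ?case
  proof (cases "E = {}")
    case True
    show ?thesis
    proof (cases "card V = 1")
      case True
      \<comment> \<open>For one vertex the witness is 1: the exponent \<open>Suc (card V)\<close> is
        2, so the sign is positive and nothing remains besides the power sum.\<close>
      then obtain v where "V = {v}" by (auto simp: card_1_singleton_iff)
      with \<open>E = {}\<close> show ?thesis
        by (intro exI[of _ 1]) (simp add: csf_singleton mps.span_zero)
    next
      case False
      with less.prems have card: "card V \<ge> 2"
        by (metis One_nat_def card_eq_0_iff less_2_cases not_less)
      let ?M = "image_mset w (mset_set V)"
      \<comment> \<open>Without edges, two or more vertices give a product of at least two power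
        sums, so the witness is 0; such a graph is not connected.\<close>
      have "csf V w E \<in> ?D"
        using fin pos card \<open>E = {}\<close> csf_edgeless[OF fin pos]
        by (fastforce simp: mpartitions_def sum_unfold_sum_mset)
      moreover have "\<not> V \<times> V \<subseteq> E\<^sup>*"
      proof
        assume "V \<times> V \<subseteq> E\<^sup>*"
        then have "\<forall>x\<in>V. \<forall>y\<in>V. x = y" using \<open>E = {}\<close> by auto
        then have "card V \<le> 1" using fin by (auto simp: card_le_Suc0_iff_eq)
        with card show False by simp
      qed
      ultimately show ?thesis by (intro exI[of _ 0]) (simp add: mps.span_base)
    qed
  next
    case False
    then obtain u v where e: "(u, v) \<in> E" by auto
    with less.prems have uv: "u \<in> V" "v \<in> V" "u \<noteq> v" "(v, u) \<in> E"
      by (auto simp: irrefl_def sym_def)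
    define f where "f = id(v := u)"
    define w' where "w' = w(u := w u + w v)"
    define E1 where "E1 = E - {(u, v), (v, u)}"
    define E2 where "E2 = map_prod f f ` E1"
    let ?V = "V - {v}"
    have csf: "csf V w E = csf V w E1 - csf ?V w' E2"
      using csf_deletion_contraction[OF fin pos less.prems(4) uv(1,2,3) e E1_def]
      by (simp add: E2_def f_def w'_def)
    have card1: "card E1 < card E"
      using e finE by (auto simp: E1_def intro: psubset_card_mono)
    have card2: "card E2 < card E"
      using card1 finE card_image_le[of E1 "map_prod f f"] by (simp add: E1_def E2_def)
    have sum': "sum w' ?V = sum w V"
      using fin uv
      by (simp add: w'_def sum.remove[of V v] sum.remove[of ?V u])
    have cV: "card V = Suc (card ?V)" using fin uv by (simp only: card_Suc_Diff1)
    have sym1: "sym E1" "irrefl E1" "E1 \<subseteq> V \<times> V"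
      using less.prems by (auto simp: E1_def sym_def irrefl_def)
    have "\<exists>c\<ge>0. (V \<times> V \<subseteq> E1\<^sup>* \<longrightarrow> c > 0) \<and>
      csf V w E1 - mps_scale ((- 1) ^ Suc (card V) * c) (power_sum (sum w V)) \<in> mps.span ?D"
      using less.hyps[OF card1 fin less.prems(2) pos sym1(3,1,2)] .
    \<comment> \<open>Deleting the edge may disconnect the graph, so only \<open>c1 \<ge> 0\<close>
      is kept; strict positivity has to come from the contraction.\<close>
    then obtain c1 where c1: "c1 \<ge> 0"
      "csf V w E1 - mps_scale ((- 1) ^ Suc (card V) * c1) (power_sum (sum w V)) \<in> mps.span ?D"
      by blast
    have fV: "f x \<in> ?V" if "x \<in> V" for x using that uv by (auto simp: f_def)
    have sub2: "E2 \<subseteq> ?V \<times> ?V" using sym1(3) fV by (auto simp: E2_def)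
    have sym2: "sym E2" using sym1(1) by (force simp: E2_def sym_def)
    have irr2: "irrefl E2"
    proof -
      have "f x \<noteq> f y" if "(x, y) \<in> E1" for x y
        using that sym1(2) by (auto simp: f_def E1_def irrefl_def split: if_splits)
      then show ?thesis by (auto simp: irrefl_def E2_def)
    qed
    have "\<exists>c\<ge>0. (?V \<times> ?V \<subseteq> E2\<^sup>* \<longrightarrow> c > 0) \<and>
      csf ?V w' E2 - mps_scale ((- 1) ^ Suc (card ?V) * c) (power_sum (sum w' ?V))
       \<in> mps.span (mset_mult power_sum ` {M \<in> mpartitions (sum w' ?V). size M \<ge> 2})"
      by (rule less.hyps[OF card2 _ _ _ sub2 sym2 irr2])
         (use fin uv pos in \<open>auto simp: w'_def\<close>)
    then obtain c2 where c2: "c2 \<ge> 0" "?V \<times> ?V \<subseteq> E2\<^sup>* \<longrightarrow> c2 > 0"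
      "csf ?V w' E2 - mps_scale ((- 1) ^ Suc (card ?V) * c2) (power_sum (sum w V)) \<in> mps.span ?D"
      unfolding sum' by blast
    have conn: "?V \<times> ?V \<subseteq> E2\<^sup>*" if "V \<times> V \<subseteq> E\<^sup>*"
    proof (rule subrelI)
      fix a b assume "(a, b) \<in> ?V \<times> ?V"
      then have ab: "a \<in> V" "a \<noteq> v" "b \<in> V" "b \<noteq> v" by auto
      have "(f a, f b) \<in> E2\<^sup>*"
      proof (rule rtrancl_map_prod[where E = E and f = f])
        show "(a, b) \<in> E\<^sup>*" using that ab by auto
        show "f x = f y \<or> (f x, f y) \<in> E2" if "(x, y) \<in> E" for x y
          using that by (force simp: E2_def E1_def f_def)
      qed
      then show "(a, b) \<in> E2\<^sup>*" using ab by (simp add: f_def)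
    qed
    have "csf V w E - mps_scale ((- 1) ^ Suc (card V) * (c1 + c2)) (power_sum (sum w V)) =
        (csf V w E1 - mps_scale ((- 1) ^ Suc (card V) * c1) (power_sum (sum w V))) -
        (csf ?V w' E2 - mps_scale ((- 1) ^ Suc (card ?V) * c2) (power_sum (sum w V)))"
      unfolding csf cV by (rule mps_eqI) (simp add: algebra_simps)
    also have "\<dots> \<in> mps.span ?D"
      using c1(2) c2(3) by (rule mps.span_diff)
    finally show ?thesis
      using c1(1) c2(1,2) conn by (intro exI[of _ "c1 + c2"]) (auto simp: add_nonneg_pos)
  qed
qed

section \<open>Monomial symmetric functions\<close>

text \<open>The nonzero exponents with multiplicity form the complete invariant of a monomial under
  permutations of the variables.\<close>

definition exponents :: "(nat \<Rightarrow>\<^sub>0 nat) \<Rightarrow> nat multiset" where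
  "exponents m = image_mset (Poly_Mapping.lookup m) (mset_set (Poly_Mapping.keys m))"

lemma sum_mset_exponents: "\<Sum>\<^sub># (exponents m) = total_degree m"
  by (simp add: exponents_def total_degree_def sum_unfold_sum_mset)

lemma exponents_in_mpartitions: "exponents m \<in> mpartitions (total_degree m)"
  by (auto simp: mpartitions_def sum_mset_exponents) (auto simp: exponents_def in_keys_iff)

text \<open>Padding with zeros over the union of the two supports makes the exponent functions agree
  as multisets on one finite set, so a permutation of that set relates them; elsewhere both
  exponents are 0.\<close>

lemma exponents_eq_imp_map_key:
  assumes "exponents m = exponents m'"
  shows "\<exists>\<sigma>. bij \<sigma> \<and> m = Poly_Mapping.map_key \<sigma> m'"
proof -
  let ?A = "Poly_Mapping.keys m \<union> Poly_Mapping.keys m'"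
  have *: "image_mset (Poly_Mapping.lookup k) (mset_set ?A) =
      exponents k + replicate_mset (card ?A - size (exponents k)) 0"
    if k: "Poly_Mapping.keys k \<subseteq> ?A" for k :: "nat \<Rightarrow>\<^sub>0 nat"
  proof -
    let ?B = "?A - Poly_Mapping.keys k"
    have "?A = Poly_Mapping.keys k \<union> ?B" using k by auto
    then have "mset_set ?A = mset_set (Poly_Mapping.keys k) + mset_set ?B"
      by (metis Diff_disjoint finite_Diff finite_UnI finite_keys mset_set_Union)
    then have "image_mset (Poly_Mapping.lookup k) (mset_set ?A) =
        exponents k + image_mset (Poly_Mapping.lookup k) (mset_set ?B)"
      by (simp add: exponents_def)
    also have "image_mset (Poly_Mapping.lookup k) (mset_set ?B) = image_mset (\<lambda>_. 0) (mset_set ?B)"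
      by (intro image_mset_cong) (auto simp: in_keys_iff)
    also have "\<dots> = replicate_mset (card ?B) 0" by (simp add: image_mset_const_eq)
    also have "card ?B = card ?A - size (exponents k)"
      using k by (simp add: card_Diff_subset exponents_def)
    finally show ?thesis .
  qed
  have "image_mset (Poly_Mapping.lookup m) (mset_set ?A) = image_mset (Poly_Mapping.lookup m') (mset_set ?A)"
    using *[of m] *[of m'] assms by simp
  then obtain p where p: "p permutes ?A"
    "\<forall>x\<in>?A. Poly_Mapping.lookup m x = Poly_Mapping.lookup m' (p x)"
    by (rule image_mset_eq_implies_permutes[rotated]) simp_all
  have bij: "bij p" using p(1) by (rule permutes_bij)
  have "Poly_Mapping.lookup m x = Poly_Mapping.lookup m' (p x)" for x
  proof (cases "x \<in> ?A")
    case True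
    with p(2) show ?thesis by blast
  next
    case False
    with permutes_not_in[OF p(1) this] show ?thesis by (simp add: in_keys_iff)
  qed
  then have "m = Poly_Mapping.map_key p m'"
    using bij by (intro poly_mapping_eqI) (simp add: map_key.rep_eq bij_is_inj)
  with bij show ?thesis by blast
qed

lemma symmetric_series_cong_exponents:
  assumes "symmetric_series f" "exponents m = exponents m'"
  shows "mps_coeff f m = mps_coeff f m'"
  using assms exponents_eq_imp_map_key[OF assms(2)] by (auto simp: symmetric_series_def)

lemma ex_exponents: "0 \<notin># M \<Longrightarrow> \<exists>m. exponents m = M"
proof (induction M)
  case empty
  then show ?case by (intro exI[of _ 0]) (simp add: exponents_def)
next
  case (add k M)
  then obtain m where m: "exponents m = M" by auto
  obtain i where i: "i \<notin> Poly_Mapping.keys m"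
    using ex_new_if_finite[OF infinite_UNIV_nat finite_keys] by blast
  have k: "k > 0" using add.prems by auto
  let ?m = "m + Poly_Mapping.single i k"
  have keys: "Poly_Mapping.keys ?m = insert i (Poly_Mapping.keys m)"
    using i k by (auto simp: in_keys_iff lookup_add lookup_single when_def split: if_splits)
  have "exponents ?m = add_mset (Poly_Mapping.lookup ?m i)
      (image_mset (Poly_Mapping.lookup ?m) (mset_set (Poly_Mapping.keys m)))"
    using i by (simp add: exponents_def keys)
  also have "image_mset (Poly_Mapping.lookup ?m) (mset_set (Poly_Mapping.keys m)) = exponents m"
    unfolding exponents_def using i by (intro image_mset_cong) (auto simp: lookup_add lookup_single when_def)
  also have "Poly_Mapping.lookup ?m i = k"
    using i by (simp add: lookup_add in_keys_iff)
  finally show ?case using m by blast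
qed

text \<open>Any representative of the orbit serves, since a symmetric series has the same
  coefficient on the whole orbit.\<close>

definition monomial_with :: "nat multiset \<Rightarrow> (nat \<Rightarrow>\<^sub>0 nat)" where
  "monomial_with M = (SOME m. exponents m = M)"

lemma exponents_monomial_with: "0 \<notin># M \<Longrightarrow> exponents (monomial_with M) = M"
  unfolding monomial_with_def using someI_ex[OF ex_exponents] .

text \<open>
  In a proper colouring of a complete graph all colours are distinct, so the series of a weighted
  complete graph is a positive multiple of the monomial symmetric function of its weights.
\<close>

definition clique_csf :: "nat multiset \<Rightarrow> power_series" where
  "clique_csf M = (let m = monomial_with M; K = Poly_Mapping.keys m in
     csf K (Poly_Mapping.lookup m) (K \<times> K - Id))"

lemma finite_mpartitions: "finite (mpartitions n)"
proof -
  have "M \<in> mset ` {xs. set xs \<subseteq> {..n} \<and> length xs \<le> n}" if M: "M \<in> mpartitions n" for M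
  proof -
    \<comment> \<open>Positive parts bound both their number and their size by the sum, so lists
      from a finite set suffice.\<close>
    have "size M \<le> \<Sum>\<^sub># M" "\<forall>k\<in>#M. k \<le> \<Sum>\<^sub># M" if "0 \<notin># M" for M :: "nat multiset"
      using that by (induction M) (auto simp: trans_le_add2)
    with M have "size M \<le> n" "\<forall>k\<in>#M. k \<le> n" by (auto simp: mpartitions_def)
    moreover obtain xs where "M = mset xs" by (metis ex_mset)
    ultimately show ?thesis by (auto simp: image_iff intro!: exI[of _ xs])
  qed
  moreover have "finite {xs. set xs \<subseteq> {..n} \<and> length xs \<le> n}"
    by (rule finite_lists_length_le) simp
  ultimately show ?thesis by (meson finite_imageI finite_subset subsetI)
qed

lemma mpartitions_total_degree:
  assumes "M \<in> mpartitions n"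
  shows "exponents (monomial_with M) = M" "total_degree (monomial_with M) = n"
  using assms exponents_monomial_with[of M] sum_mset_exponents[of "monomial_with M"]
  by (auto simp: mpartitions_def)

lemma clique_csf_in_Sym_homog:
  assumes "M \<in> mpartitions n"
  shows "clique_csf M \<in> Sym_homog n"
  using csf_in_Sym_homog[of "Poly_Mapping.keys (monomial_with M) \<times> Poly_Mapping.keys (monomial_with M) - Id"
      "Poly_Mapping.keys (monomial_with M)" "Poly_Mapping.lookup (monomial_with M)"]
    mpartitions_total_degree(2)[OF assms]
  by (simp add: clique_csf_def Let_def total_degree_def)

text \<open>With distinct colours no two weights meet in one exponent.\<close>

lemma exponents_colour_mono:
  assumes fin: "finite V" and pos: "\<And>v. v \<in> V \<Longrightarrow> w v > 0" and inj: "inj_on \<kappa> V"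
  shows "exponents (colour_mono V w \<kappa>) = image_mset w (mset_set V)"
proof -
  have "mset_set (\<kappa> ` V) = image_mset \<kappa> (mset_set V)"
    using inj by (simp add: image_mset_mset_set)
  moreover have "Poly_Mapping.lookup (colour_mono V w \<kappa>) (\<kappa> v) = w v" if v: "v \<in> V" for v
  proof -
    have "(\<Sum>u\<in>V. if \<kappa> u = \<kappa> v then w u else 0) = (\<Sum>u\<in>V. if u = v then w u else 0)"
      using inj v by (intro sum.cong) (auto simp: inj_on_def)
    then show ?thesis using fin v by (simp add: lookup_colour_mono)
  qed
  ultimately show ?thesis
    using fin by (auto simp: exponents_def keys_colour_mono[OF fin pos] multiset.map_comp intro!: image_mset_cong)
qed

text \<open>A contributing colouring is injective on the clique, so the exponents are the weights.
  Together with \<open>mps_coeff_clique_csf_monomial_with\<close>, this makes the matrix of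
  coefficients of \<open>clique_csf M\<close> at \<open>monomial_with N\<close> diagonal with
  nonzero diagonal, which yields both spanning and independence.\<close>

lemma mps_coeff_clique_csf_imp:
  assumes M: "0 \<notin># M" and nz: "mps_coeff (clique_csf M) m \<noteq> 0"
  shows "exponents m = M"
proof -
  let ?K = "Poly_Mapping.keys (monomial_with M)" and ?w = "Poly_Mapping.lookup (monomial_with M)"
  have "{\<kappa> \<in> colourings ?K (?K \<times> ?K - Id). colour_mono ?K ?w \<kappa> = m} \<noteq> {}"
    using nz unfolding clique_csf_def Let_def csf_def mps_coeff_genfun by fastforce
  then obtain \<kappa> where \<kappa>: "\<kappa> \<in> colourings ?K (?K \<times> ?K - Id)" "colour_mono ?K ?w \<kappa> = m" by auto
  have "inj_on \<kappa> ?K"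
    using colouringsD[OF \<kappa>(1)] by (fastforce simp: inj_on_def)
  then have "exponents m = image_mset ?w (mset_set ?K)"
    unfolding \<kappa>(2)[symmetric] by (intro exponents_colour_mono) (auto simp: in_keys_iff)
  also have "\<dots> = M" using exponents_monomial_with[OF M] by (simp add: exponents_def)
  finally show ?thesis .
qed

lemma mps_coeff_clique_csf_monomial_with:
  "mps_coeff (clique_csf M) (monomial_with M) \<noteq> 0"
proof -
  let ?m = "monomial_with M"
  let ?K = "Poly_Mapping.keys ?m" and ?w = "Poly_Mapping.lookup ?m"
  let ?S = "{\<kappa> \<in> colourings ?K (?K \<times> ?K - Id). colour_mono ?K ?w \<kappa> = ?m}"
  \<comment> \<open>The vertices of the clique are the variables themselves, so the identity
    colouring reproduces the monomial.\<close>
  have "colour_mono ?K ?w (restrict id ?K) = ?m"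
  proof (rule poly_mapping_eqI)
    fix i
    have "(\<Sum>v\<in>?K. if restrict id ?K v = i then ?w v else 0) = (\<Sum>v\<in>?K. if v = i then ?w v else 0)"
      by (intro sum.cong) auto
    then show "Poly_Mapping.lookup (colour_mono ?K ?w (restrict id ?K)) i = ?w i"
      by (simp add: lookup_colour_mono in_keys_iff)
  qed
  then have "restrict id ?K \<in> ?S"
    by (auto intro!: colouringsI)
  moreover have "finite ?S"
    using finite_fibres_colourings[of ?K ?w] by (simp add: finite_fibres_def in_keys_iff)
  ultimately have "card ?S > 0" using card_gt_0_iff[of ?S] by blast
  then show ?thesis
    by (simp add: clique_csf_def Let_def csf_def mps_coeff_genfun)
qed

lemma Sym_homog_subset_span_clique_csf:
  "Sym_homog n \<subseteq> mps.span (clique_csf ` mpartitions n)"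
proof
  fix f assume f: "f \<in> Sym_homog n"
  \<comment> \<open>Among the clique series only \<open>clique_csf M\<close> has a nonzero
    coefficient at \<open>monomial_with M\<close>, so this quotient is the only possible
    scalar.\<close>
  define a where "a M = mps_coeff f (monomial_with M) / mps_coeff (clique_csf M) (monomial_with M)" for M
  have "f = (\<Sum>M\<in>mpartitions n. mps_scale (a M) (clique_csf M))"
  proof (rule mps_eqI)
    fix m
    show "mps_coeff f m = mps_coeff (\<Sum>M\<in>mpartitions n. mps_scale (a M) (clique_csf M)) m"
    proof (cases "total_degree m = n")
      case True
      let ?N = "exponents m"
      have N: "?N \<in> mpartitions n" using exponents_in_mpartitions[of m] True by simp
      have "mps_coeff (clique_csf M) m = 0" if "M \<in> mpartitions n" "M \<noteq> ?N" for M
        using mps_coeff_clique_csf_imp[of M m] that by (auto simp: mpartitions_def)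
      then have "(\<Sum>M\<in>mpartitions n. a M * mps_coeff (clique_csf M) m) =
          (\<Sum>M\<in>{?N}. a M * mps_coeff (clique_csf M) m)"
        using N by (intro sum.mono_neutral_right) (auto simp: finite_mpartitions)
      also have "\<dots> = a ?N * mps_coeff (clique_csf ?N) (monomial_with ?N)"
        using symmetric_series_cong_exponents[of "clique_csf ?N" m "monomial_with ?N"]
          clique_csf_in_Sym_homog[OF N] mpartitions_total_degree(1)[OF N]
        by (simp add: Sym_homog_def)
      also have "\<dots> = mps_coeff f (monomial_with ?N)"
        by (simp add: a_def mps_coeff_clique_csf_monomial_with)
      also have "\<dots> = mps_coeff f m"
        using f mpartitions_total_degree(1)[OF N]
        by (intro symmetric_series_cong_exponents) (auto simp: Sym_homog_def)
      finally show ?thesis by simp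
    next
      case False
      have "mps_coeff f m = 0" "M \<in> mpartitions n \<Longrightarrow> mps_coeff (clique_csf M) m = 0" for M
        using f clique_csf_in_Sym_homog[of M n] False
        by (auto simp: Sym_homog_def homogeneous_series_def)
      then show ?thesis by simp
    qed
  qed
  also have "\<dots> \<in> mps.span (clique_csf ` mpartitions n)"
    by (intro mps.span_sum mps.span_scale mps.span_base imageI)
  finally show "f \<in> mps.span (clique_csf ` mpartitions n)" .
qed

section \<open>Power sums span each degree\<close>

lemma csf_in_span_power_sum:
  assumes "finite V" "\<And>v. v \<in> V \<Longrightarrow> w v > 0" "E \<subseteq> V \<times> V" "sym E" "irrefl E"
  shows "csf V w E \<in> mps.span (mset_mult power_sum ` mpartitions (sum w V))"
proof (cases "V = {}")
  case True
  then have "csf V w E = mset_mult power_sum {#}" using assms(3) by (simp add: csf_empty)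
  moreover have "{#} \<in> mpartitions (sum w V)" using True by (simp add: mpartitions_def)
  ultimately show ?thesis by (simp only: mps.span_base imageI)
next
  case False
  let ?n = "sum w V"
  let ?U = "mset_mult power_sum ` mpartitions ?n"
  obtain c where c: "csf V w E - mps_scale c (power_sum ?n)
      \<in> mps.span (mset_mult power_sum ` {M \<in> mpartitions ?n. size M \<ge> 2})"
    using csf_power_sum_expansion[of V w E, OF assms(1) False assms(2-5)] by blast
  \<comment> \<open>Parts must be positive, so the power sum itself counts as a one-part product
    only because the total weight is nonzero.\<close>
  have "?n > 0" using assms(1,2) False by (intro sum_pos) auto
  then have "{#?n#} \<in> mpartitions ?n" by (auto simp: mpartitions_def)
  then have "mset_mult power_sum {#?n#} \<in> mps.span ?U" by (intro mps.span_base imageI)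
  then have "mps_scale c (power_sum ?n) \<in> mps.span ?U" by (simp add: mps.span_scale)
  moreover have "csf V w E - mps_scale c (power_sum ?n) \<in> mps.span ?U"
    by (rule subsetD[OF mps.span_mono c]) blast
  ultimately have "(csf V w E - mps_scale c (power_sum ?n)) + mps_scale c (power_sum ?n) \<in> mps.span ?U"
    by (intro mps.span_add)
  then show ?thesis by simp
qed

text \<open>The clique series spanning this degree are themselves series of weighted graphs, so the
  expansion into power sums applies to each.\<close>

lemma Sym_homog_subset_span_power_sum:
  "Sym_homog n \<subseteq> mps.span (mset_mult power_sum ` mpartitions n)"
proof -
  have "clique_csf M \<in> mps.span (mset_mult power_sum ` mpartitions n)" if M: "M \<in> mpartitions n" for M
  proof -
    let ?m = "monomial_with M"
    let ?K = "Poly_Mapping.keys ?m"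
    have "csf ?K (Poly_Mapping.lookup ?m) (?K \<times> ?K - Id)
        \<in> mps.span (mset_mult power_sum ` mpartitions (sum (Poly_Mapping.lookup ?m) ?K))"
      by (rule csf_in_span_power_sum) (auto simp: in_keys_iff sym_def irrefl_def)
    then show ?thesis
      using mpartitions_total_degree(2)[OF M] by (simp add: clique_csf_def Let_def total_degree_def)
  qed
  then have "mps.span (clique_csf ` mpartitions n) \<subseteq> mps.span (mset_mult power_sum ` mpartitions n)"
    by (intro mps.span_minimal) auto
  with Sym_homog_subset_span_clique_csf show ?thesis by blast
qed

section \<open>From power sums to other multiplicative generators\<close>

lemma subspace_Sym_homog: "mps.subspace (Sym_homog n)"
  unfolding mps.subspace_def Sym_homog_def symmetric_series_def homogeneous_series_def
  by (auto simp: algebra_simps) (metis add_0)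

lemma mpartitions_union: "M \<in> mpartitions a \<Longrightarrow> N \<in> mpartitions b \<Longrightarrow> M + N \<in> mpartitions (a + b)"
  by (auto simp: mpartitions_def)

text \<open>Each factor is expanded and the product multiplied out; the parts of the factors combine
  by multiset union, under which the sums add.\<close>

lemma mset_mult_in_span:
  assumes "\<And>k. k \<in># M \<Longrightarrow> y k \<in> mps.span (mset_mult x ` mpartitions k)"
  shows "mset_mult y M \<in> mps.span (mset_mult x ` mpartitions (\<Sum>\<^sub># M))"
  using assms
proof (induction M)
  case empty
  have "mset_mult x {#} \<in> mps.span (mset_mult x ` mpartitions 0)"
    by (intro mps.span_base imageI) (simp add: mpartitions_def)
  then show ?case by simp
next
  case (add k M)
  have "y k * mset_mult y M \<in> mps.span (mset_mult x ` mpartitions (k + \<Sum>\<^sub># M))"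
  proof (rule mps_span_mult)
    show "y k \<in> mps.span (mset_mult x ` mpartitions k)"
      "mset_mult y M \<in> mps.span (mset_mult x ` mpartitions (\<Sum>\<^sub># M))"
      using add by auto
    fix f g assume "f \<in> mset_mult x ` mpartitions k" "g \<in> mset_mult x ` mpartitions (\<Sum>\<^sub># M)"
    then show "f * g \<in> mps.span (mset_mult x ` mpartitions (k + \<Sum>\<^sub># M))"
      by (auto simp flip: mset_mult_union intro!: mps.span_base imageI mpartitions_union)
  qed
  then show ?case by simp
qed

text \<open>Strong induction: products of two or more power sums involve only smaller indices,
  already expressed through \<open>x\<close>, and since \<open>c\<close> is nonzero the relation for
  \<open>x n\<close> can be solved for \<open>power_sum n\<close>.\<close>

lemma power_sum_in_span:
  assumes x: "\<And>n. n > 0 \<Longrightarrow> \<exists>c\<noteq>0. x n - mps_scale c (power_sum n)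
      \<in> mps.span (mset_mult power_sum ` {M \<in> mpartitions n. size M \<ge> 2})"
    and "n > 0"
  shows "power_sum n \<in> mps.span (mset_mult x ` mpartitions n)"
  using \<open>n > 0\<close>
proof (induction n rule: less_induct)
  case (less n)
  let ?U = "mset_mult x ` mpartitions n"
  obtain c where c: "c \<noteq> 0" "x n - mps_scale c (power_sum n)
      \<in> mps.span (mset_mult power_sum ` {M \<in> mpartitions n. size M \<ge> 2})"
    using x[OF less.prems] by blast
  have "mset_mult power_sum M \<in> mps.span ?U" if M: "M \<in> mpartitions n" "size M \<ge> 2" for M
  proof -
    have "power_sum k \<in> mps.span (mset_mult x ` mpartitions k)" if k: "k \<in># M" for k
    proof -
      obtain N where N: "M = add_mset k N" using k by (metis multi_member_split)
      \<comment> \<open>A second part \<open>j\<close>, being positive, keeps \<open>k\<close>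
        strictly below \<open>n\<close>, as the induction requires.\<close>
      with M obtain j where "j \<in># N" by (cases N) auto
      then obtain N' where "M = add_mset k (add_mset j N')" using N by (metis multi_member_split)
      with M have "k < n" "k > 0" by (auto simp: mpartitions_def)
      then show ?thesis by (rule less.IH)
    qed
    then show ?thesis
      using mset_mult_in_span[of M power_sum x] M(1) by (simp add: mpartitions_def)
  qed
  then have "mps.span (mset_mult power_sum ` {M \<in> mpartitions n. size M \<ge> 2}) \<subseteq> mps.span ?U"
    by (intro mps.span_minimal) auto
  with c have "x n - mps_scale c (power_sum n) \<in> mps.span ?U" by blast
  moreover have "{#n#} \<in> mpartitions n" using less.prems by (auto simp: mpartitions_def)
  then have "mset_mult x {#n#} \<in> mps.span ?U" by (intro mps.span_base imageI)
  then have "x n \<in> mps.span ?U" by simp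
  ultimately have "x n - (x n - mps_scale c (power_sum n)) \<in> mps.span ?U"
    by (rule mps.span_diff[rotated])
  then have "mps_scale (1 / c) (x n - (x n - mps_scale c (power_sum n))) \<in> mps.span ?U"
    by (rule mps.span_scale)
  then show ?case using c(1) by simp
qed

text \<open>The first assumption lets \<open>x\<close> replace the power sums in a family spanning
  this degree; the second gives the reverse inclusion.\<close>

lemma Sym_homog_eq_span:
  assumes x: "\<And>n. n > 0 \<Longrightarrow> \<exists>c\<noteq>0. x n - mps_scale c (power_sum n)
      \<in> mps.span (mset_mult power_sum ` {M \<in> mpartitions n. size M \<ge> 2})"
    and sym: "\<And>n M. M \<in> mpartitions n \<Longrightarrow> mset_mult x M \<in> Sym_homog n"
  shows "Sym_homog n = mps.span (mset_mult x ` mpartitions n)"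
proof
  have "mset_mult power_sum M \<in> mps.span (mset_mult x ` mpartitions n)" if "M \<in> mpartitions n" for M
  proof -
    have "power_sum k \<in> mps.span (mset_mult x ` mpartitions k)" if "k \<in># M" for k
    proof (rule power_sum_in_span[of x k, OF x])
      show "k > 0" using that \<open>M \<in> mpartitions n\<close> by (auto simp: mpartitions_def intro: gr0I)
    qed
    then show ?thesis
      using mset_mult_in_span[of M power_sum x] \<open>M \<in> mpartitions n\<close> by (simp add: mpartitions_def)
  qed
  then have "mps.span (mset_mult power_sum ` mpartitions n) \<subseteq> mps.span (mset_mult x ` mpartitions n)"
    by (intro mps.span_minimal) auto
  with Sym_homog_subset_span_power_sum show "Sym_homog n \<subseteq> mps.span (mset_mult x ` mpartitions n)"
    by blast
  show "mps.span (mset_mult x ` mpartitions n) \<subseteq> Sym_homog n"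
    using sym subspace_Sym_homog by (intro mps.span_minimal) auto
qed

section \<open>Multiplicative bases and free generation\<close>

text \<open>Reading off the coefficient at \<open>monomial_with N\<close> isolates the scalar of
  \<open>N\<close>. This supplies the lower bound in the later dimension count.\<close>

lemma clique_csf_independent:
  "inj_on clique_csf (mpartitions n)" "mps.independent (clique_csf ` mpartitions n)"
proof -
  have eq: "M = N" if "M \<in> mpartitions n" "N \<in> mpartitions n"
    "mps_coeff (clique_csf M) (monomial_with N) \<noteq> 0" for M N
    using mps_coeff_clique_csf_imp[of M "monomial_with N"] mpartitions_total_degree(1)[of N] that
    by (auto simp: mpartitions_def)
  show inj: "inj_on clique_csf (mpartitions n)"
    by (rule inj_onI) (metis eq mps_coeff_clique_csf_monomial_with)
  show "mps.independent (clique_csf ` mpartitions n)"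
  proof (rule mps.independent_if_scalars_zero)
    show "finite (clique_csf ` mpartitions n)" by (simp add: finite_mpartitions)
    fix u f
    assume 0: "(\<Sum>f\<in>clique_csf ` mpartitions n. mps_scale (u f) f) = 0"
      and "f \<in> clique_csf ` mpartitions n"
    then obtain N where N: "N \<in> mpartitions n" "f = clique_csf N" by auto
    have "(\<Sum>M\<in>mpartitions n. mps_scale (u (clique_csf M)) (clique_csf M)) = 0"
      using 0 by (simp add: sum.reindex[OF inj])
    then have "(\<Sum>M\<in>mpartitions n. u (clique_csf M) * mps_coeff (clique_csf M) (monomial_with N)) = 0"
      by (metis (no_types, lifting) mps_coeff_scale mps_coeff_sum mps_coeff_zero sum.cong)
    moreover have "(\<Sum>M\<in>mpartitions n. u (clique_csf M) * mps_coeff (clique_csf M) (monomial_with N)) =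
      (\<Sum>M\<in>{N}. u (clique_csf M) * mps_coeff (clique_csf M) (monomial_with N))"
      using N eq by (intro sum.mono_neutral_right) (auto simp: finite_mpartitions)
    ultimately show "u f = 0" using N(2) mps_coeff_clique_csf_monomial_with by simp
  qed
qed

section \<open>Partitions and exponent vectors as multisets\<close>

text \<open>A weakly decreasing list is the reverse of its sorted version, which its multiset
  determines.\<close>

lemma inj_on_mset_partitions: "inj_on mset {\<mu>. is_partition \<mu>}"
proof (rule inj_onI)
  fix \<mu> \<nu> :: "nat list"
  assume \<mu>: "\<mu> \<in> {\<mu>. is_partition \<mu>}" "\<nu> \<in> {\<mu>. is_partition \<mu>}" "mset \<mu> = mset \<nu>"
  have "sort \<mu> = rev \<mu>" "sort \<nu> = rev \<nu>"
    using \<mu>(1,2) by (auto intro!: properties_for_sort simp: is_partition_def sorted_wrt_rev)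
  moreover have "sort \<mu> = sort \<nu>"
    using \<mu>(3) by (intro properties_for_sort) simp_all
  ultimately show "\<mu> = \<nu>" by (metis rev_rev_ident)
qed

lemma mset_image_partitions: "mset ` {\<mu>. is_partition \<mu>} = {M. 0 \<notin># M}"
proof
  show "mset ` {\<mu>. is_partition \<mu>} \<subseteq> {M. 0 \<notin># M}" by (auto simp: is_partition_def)
  show "{M. 0 \<notin># M} \<subseteq> mset ` {\<mu>. is_partition \<mu>}"
  proof
    fix M :: "nat multiset" assume "M \<in> {M. 0 \<notin># M}"
    then have "is_partition (rev (sorted_list_of_multiset M))"
      by (auto simp: is_partition_def sorted_wrt_rev intro: gr0I)
    moreover have "mset (rev (sorted_list_of_multiset M)) = M" by simp
    ultimately show "M \<in> mset ` {\<mu>. is_partition \<mu>}" by (metis image_eqI mem_Collect_eq)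
  qed
qed

lemma mset_image_partitions_of: "mset ` partitions_of n = mpartitions n"
proof -
  have "mset ` partitions_of n = {M \<in> mset ` {\<mu>. is_partition \<mu>}. \<Sum>\<^sub># M = n}"
    by (auto simp: partitions_of_def sum_mset_sum_list)
  then show ?thesis by (simp add: mset_image_partitions mpartitions_def)
qed

text \<open>For monomials of the polynomial ring: the exponent of the variable \<open>i\<close>
  becomes the multiplicity of the part \<open>i\<close>. In contrast, \<open>exponents\<close>
  forgets the variables and keeps the exponents as parts.\<close>

definition mset_of_exponents :: "(nat \<Rightarrow>\<^sub>0 nat) \<Rightarrow> nat multiset" where
  "mset_of_exponents m = Abs_multiset (Poly_Mapping.lookup m)"

lemma count_mset_of_exponents: "count (mset_of_exponents m) = Poly_Mapping.lookup m"
proof -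
  have "{i. Poly_Mapping.lookup m i > 0} = Poly_Mapping.keys m" by (auto simp: in_keys_iff)
  then show ?thesis unfolding mset_of_exponents_def by (intro count_Abs_multiset) simp
qed

lemma set_mset_of_exponents: "set_mset (mset_of_exponents m) = Poly_Mapping.keys m"
  by (simp add: set_mset_def count_mset_of_exponents set_eq_iff in_keys_iff)

lemma inj_mset_of_exponents: "inj mset_of_exponents"
  by (rule injI) (metis count_mset_of_exponents poly_mapping.lookup_inject)

section \<open>Sequences whose products span each degree\<close>

text \<open>Graphs enter only through this spanning property; independence is then derived from it
  by counting.\<close>

locale multiplicative_sequence =
  fixes x :: "nat \<Rightarrow> power_series"
  assumes Sym_homog_eq: "Sym_homog n = mps.span (mset_mult x ` mpartitions n)"
begin

lemma independent_homog:
  "inj_on (mset_mult x) (mpartitions n)" "mps.independent (mset_mult x ` mpartitions n)"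
proof -
  let ?C = "clique_csf ` mpartitions n" and ?U = "mset_mult x ` mpartitions n"
  have CU: "?C \<subseteq> mps.span ?U"
    using clique_csf_in_Sym_homog Sym_homog_eq by auto
  \<comment> \<open>A spanning family as large as an independent one is itself independent.\<close>
  have card_C: "card ?C = card (mpartitions n)"
    using clique_csf_independent(1) by (rule card_image)
  have fin: "finite ?U" by (simp add: finite_mpartitions)
  \<comment> \<open>By the exchange bound, a finite set whose span contains the independent clique
    series is at least as large as their number.\<close>
  have bound: "card ?C \<le> card T" if "finite T" "?C \<subseteq> mps.span T" for T
    using mps.independent_span_bound[OF that(1) clique_csf_independent(2) that(2)] by blast
  \<comment> \<open>An image is never larger than its index set, so equality holds and forces
    injectivity.\<close>
  have card_U: "card ?U = card (mpartitions n)"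
    using bound[OF fin CU] card_C card_image_le[of "mpartitions n" "mset_mult x"]
    by (simp add: finite_mpartitions)
  then show "inj_on (mset_mult x) (mpartitions n)"
    by (intro eq_card_imp_inj_on finite_mpartitions)
  show "mps.independent ?U"
  proof
    assume "mps.dependent ?U"
    then obtain a where a: "a \<in> ?U" "a \<in> mps.span (?U - {a})"
      by (auto simp: mps.dependent_def)
    then have "mps.span (?U - {a}) = mps.span ?U"
      using mps.span_redundant[OF a(2)] by (simp add: insert_absorb)
    then have "card ?C \<le> card (?U - {a})"
      using fin CU by (intro bound) auto
    also have "\<dots> < card ?U" using a(1) fin by (intro card_Diff1_less)
    finally show False using card_C card_U by simp
  qed
qed

lemma scalars_zero_homog:
  assumes "(\<Sum>M\<in>mpartitions n. mps_scale (a M) (mset_mult x M)) = 0" "N \<in> mpartitions n"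
  shows "a N = 0"
proof -
  note inj = independent_homog(1)[of n]
  \<comment> \<open>Independence concerns the set of values, so the scalars are pulled back to it
    along the injective indexing.\<close>
  let ?u = "a \<circ> the_inv_into (mpartitions n) (mset_mult x)"
  have "(\<Sum>f\<in>mset_mult x ` mpartitions n. mps_scale (?u f) f) = 0"
    using assms(1) by (simp add: sum.reindex[OF inj] the_inv_into_f_f[OF inj])
  then have "?u (mset_mult x N) = 0"
    using assms(2)
    by (intro mps.independentD[OF independent_homog(2)[of n]]) (auto simp: finite_mpartitions)
  then show ?thesis using assms(2) by (simp add: the_inv_into_f_f[OF inj])
qed

lemma mset_mult_in_Sym_homog: "0 \<notin># M \<Longrightarrow> mset_mult x M \<in> Sym_homog (\<Sum>\<^sub># M)"
  unfolding Sym_homog_eq by (intro mps.span_base imageI) (simp add: mpartitions_def)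

text \<open>The products are homogeneous, so the part of the relation in the degree of
  \<open>N\<close> is again a relation, now within one degree.\<close>

lemma scalars_zero:
  assumes fin: "finite J" and pos: "\<And>M. M \<in> J \<Longrightarrow> 0 \<notin># M"
    and 0: "(\<Sum>M\<in>J. mps_scale (a M) (mset_mult x M)) = 0" and N: "N \<in> J"
  shows "a N = 0"
proof -
  let ?n = "\<Sum>\<^sub># N"
  \<comment> \<open>Extension by 0 lets the sum run over all of \<open>mpartitions ?n\<close>, as
    \<open>scalars_zero_homog\<close> expects.\<close>
  let ?b = "\<lambda>M. if M \<in> J then a M else 0"
  have deg: "mps_coeff (mset_mult x M) m = 0" if "0 \<notin># M" "total_degree m \<noteq> \<Sum>\<^sub># M" for M m
    using mset_mult_in_Sym_homog[OF that(1)] that(2)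
    by (auto simp: Sym_homog_def homogeneous_series_def)
  have "(\<Sum>M\<in>mpartitions ?n. mps_scale (?b M) (mset_mult x M)) = 0"
  proof (rule mps_eqI)
    fix m
    have "(\<Sum>M\<in>mpartitions ?n. ?b M * mps_coeff (mset_mult x M) m) = 0"
    proof (cases "total_degree m = ?n")
      case True
      have "(\<Sum>M\<in>mpartitions ?n. ?b M * mps_coeff (mset_mult x M) m) =
          (\<Sum>M\<in>J \<inter> mpartitions ?n. a M * mps_coeff (mset_mult x M) m)"
        by (intro sum.mono_neutral_cong_right) (auto simp: finite_mpartitions)
      also have "\<dots> = (\<Sum>M\<in>J. a M * mps_coeff (mset_mult x M) m)"
      proof (rule sum.mono_neutral_left[OF fin]; (rule ballI)?)
        fix M assume M: "M \<in> J - J \<inter> mpartitions ?n"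
        then have "mps_coeff (mset_mult x M) m = 0"
          using pos[of M] True by (intro deg) (auto simp: mpartitions_def)
        then show "a M * mps_coeff (mset_mult x M) m = 0" by simp
      qed simp
      also have "\<dots> = mps_coeff (\<Sum>M\<in>J. mps_scale (a M) (mset_mult x M)) m" by simp
      finally show ?thesis unfolding 0 by simp
    next
      case False
      then show ?thesis
        by (intro sum.neutral ballI) (simp add: deg mpartitions_def)
    qed
    then show "mps_coeff (\<Sum>M\<in>mpartitions ?n. mps_scale (?b M) (mset_mult x M)) m = mps_coeff 0 m"
      by simp
  qed
  then have "?b N = 0"
    using pos[OF N] by (intro scalars_zero_homog[where a = ?b and N = N]) (simp_all add: mpartitions_def)
  then show ?thesis using N by simp
qed

lemma inj_on_mset_mult: "inj_on (mset_mult x) {M. 0 \<notin># M}"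
proof (rule inj_onI, rule ccontr)
  fix M N assume MN: "M \<in> {M. 0 \<notin># M}" "N \<in> {M. 0 \<notin># M}" "mset_mult x M = mset_mult x N" "M \<noteq> N"
  \<comment> \<open>Equal products would give a nontrivial relation with scalars 1 and -1.\<close>
  have "(\<Sum>K\<in>{M, N}. mps_scale (if K = M then 1 else - 1) (mset_mult x K)) = 0"
    using MN(3,4) by simp
  then have "(if M = M then 1 else - 1 :: rat) = 0"
    using MN(1,2) by (intro scalars_zero[of "{M, N}"]) auto
  then show False by simp
qed

lemma independent_mset_mult: "mps.independent (mset_mult x ` {M. 0 \<notin># M})"
  unfolding mps.independent_explicit_finite_subsets
proof (intro allI impI ballI)
  fix S u f
  assume S: "S \<subseteq> mset_mult x ` {M. 0 \<notin># M}" "finite S"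
    and 0: "(\<Sum>f\<in>S. mps_scale (u f) f) = 0" and f: "f \<in> S"
  obtain J where J: "J \<subseteq> {M. 0 \<notin># M}" "finite J" "S = mset_mult x ` J"
    using finite_subset_image[OF S(2,1)] by blast
  have inj: "inj_on (mset_mult x) J" using inj_on_mset_mult J(1) by (rule inj_on_subset)
  obtain N where N: "N \<in> J" "f = mset_mult x N" using f J(3) by blast
  have "(\<Sum>M\<in>J. mps_scale (u (mset_mult x M)) (mset_mult x M)) = 0"
    using 0 J(3) by (simp add: sum.reindex[OF inj])
  then have "u (mset_mult x N) = 0"
    using J N by (intro scalars_zero[where a = "\<lambda>M. u (mset_mult x M)" and J = J]) auto
  then show "u f = 0" using N by simp
qed

lemma Sym_eq_span: "Sym = mps.span (mset_mult x ` {M. 0 \<notin># M})"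
proof
  have "Sym_homog n \<subseteq> mps.span (mset_mult x ` {M. 0 \<notin># M})" for n
    unfolding Sym_homog_eq by (intro mps.span_mono) (auto simp: mpartitions_def)
  then show "Sym \<subseteq> mps.span (mset_mult x ` {M. 0 \<notin># M})"
    unfolding Sym_def by (intro mps.span_minimal) auto
  show "mps.span (mset_mult x ` {M. 0 \<notin># M}) \<subseteq> Sym"
    unfolding Sym_def using mset_mult_in_Sym_homog by (intro mps.span_mono) blast
qed

lemma is_subalgebra_Sym: "is_subalgebra Sym"
  unfolding is_subalgebra_def Sym_eq_span
proof (intro conjI ballI)
  have "mset_mult x {#} \<in> mps.span (mset_mult x ` {M. 0 \<notin># M})"
    by (intro mps.span_base imageI) simp
  then show "1 \<in> mps.span (mset_mult x ` {M. 0 \<notin># M})" by simp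
  fix f g assume "f \<in> mps.span (mset_mult x ` {M. 0 \<notin># M})" "g \<in> mps.span (mset_mult x ` {M. 0 \<notin># M})"
  then show "f * g \<in> mps.span (mset_mult x ` {M. 0 \<notin># M})"
    by (rule mps_span_mult[rotated]) (auto simp flip: mset_mult_union intro!: mps.span_base imageI)
qed simp

lemma generated_subalgebra_eq_Sym: "generated_subalgebra (x ` {1..}) = Sym"
  unfolding generated_subalgebra_def
proof (rule hull_unique)
  have "mset_mult x {#n#} \<in> Sym" if "n \<ge> 1" for n
    unfolding Sym_eq_span by (intro mps.span_base imageI) (use that in auto)
  then show "x ` {1..} \<subseteq> Sym" by auto
  show "is_subalgebra Sym" by (rule is_subalgebra_Sym)
  fix A assume A: "x ` {1..} \<subseteq> A" "is_subalgebra A"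
  have "mset_mult x M \<in> A" if "0 \<notin># M" for M
    using that
  proof (induction M)
    case empty
    then show ?case using A by (simp add: is_subalgebra_def)
  next
    case (add k M)
    then have "x k \<in> A" "mset_mult x M \<in> A" using A(1) by auto
    then show ?case using A(2) by (simp add: is_subalgebra_def)
  qed
  then show "Sym \<subseteq> A"
    unfolding Sym_eq_span using A(2) by (intro mps.span_minimal) (auto simp: is_subalgebra_def)
qed

lemma poly_subst_eq:
  "poly_subst x P = (\<Sum>m\<in>Poly_Mapping.keys P.
     mps_scale (Poly_Mapping.lookup P m) (mset_mult x (mset_of_exponents m)))"
  unfolding poly_subst_def mset_mult_def
  by (simp add: image_prod_mset_multiplicity set_mset_of_exponents count_mset_of_exponents)

text \<open>Distinct monomials of \<open>P\<close> yield distinct multisets, so an algebraic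
  relation is a linear relation between products. Restricting the variables to \<open>{1..}\<close>
  keeps 0 out of these multisets.\<close>

lemma alg_independent_x: "alg_independent x {1..}"
  unfolding alg_independent_def
proof (intro ballI impI)
  fix P assume P: "P \<in> polys_in {1..}" "poly_subst x P = 0"
  let ?J = "mset_of_exponents ` Poly_Mapping.keys P"
  let ?a = "\<lambda>M. Poly_Mapping.lookup P (inv mset_of_exponents M)"
  have pos: "0 \<notin># M" if "M \<in> ?J" for M
    using that P(1) by (fastforce simp: polys_in_def set_mset_of_exponents)
  have "(\<Sum>M\<in>?J. mps_scale (?a M) (mset_mult x M)) = 0"
    using P(2) by (simp add: poly_subst_eq sum.reindex inj_on_subset[OF inj_mset_of_exponents]
        inv_f_f[OF inj_mset_of_exponents])
  then have "?a M = 0" if "M \<in> ?J" for M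
    using scalars_zero[of ?J ?a M] pos that by simp
  then have "Poly_Mapping.lookup P m = 0" if "m \<in> Poly_Mapping.keys P" for m
    using that by (force simp: inv_f_f[OF inj_mset_of_exponents])
  then have "Poly_Mapping.lookup P m = 0" for m
    by (cases "m \<in> Poly_Mapping.keys P") (auto simp: in_keys_iff)
  then show "P = 0" by (intro poly_mapping_eqI) simp
qed

text \<open>Decreasing lists of positive parts correspond bijectively to multisets without 0, so the
  results on \<open>mset_mult\<close> transfer.\<close>

lemma multiplicative_basisI:
  assumes b: "\<And>\<mu>. is_partition \<mu> \<Longrightarrow> b \<mu> = (\<Prod>k\<leftarrow>\<mu>. x k)"
  shows "multiplicative_basis b"
proof -
  have b': "b \<mu> = mset_mult x (mset \<mu>)" if "is_partition \<mu>" for \<mu>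
    using b[OF that] by (simp add: mset_mult_def prod_mset_prod_list flip: mset_map)
  have img: "b ` A = mset_mult x ` mset ` A" if "A \<subseteq> {\<mu>. is_partition \<mu>}" for A
    using that b' by (force simp: image_iff)
  have "inj_on (mset_mult x \<circ> mset) {\<mu>. is_partition \<mu>}"
    using inj_on_mset_partitions inj_on_mset_mult by (intro comp_inj_on) (simp_all add: mset_image_partitions)
  then have inj: "inj_on b {\<mu>. is_partition \<mu>}"
    by (rule inj_on_cong[THEN iffD1, rotated]) (simp add: b')
  \<comment> \<open>\<open>[k]\<close> is a partition only for positive \<open>k\<close>, which all
    parts of a partition are.\<close>
  have "b [k] = x k" if "k > 0" for k
    using that b[of "[k]"] by (simp add: is_partition_def)
  then have "b \<mu> = (\<Prod>k\<leftarrow>\<mu>. b [k])" if "is_partition \<mu>" for \<mu>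
    using b[OF that] that by (auto simp: is_partition_def cong: map_cong)
  moreover have "Sym_homog n = mps.span (b ` partitions_of n)" for n
  proof -
    have "partitions_of n \<subseteq> {\<mu>. is_partition \<mu>}" by (auto simp: partitions_of_def)
    from img[OF this] show ?thesis by (simp add: mset_image_partitions_of Sym_homog_eq)
  qed
  ultimately show ?thesis
    unfolding multiplicative_basis_def is_basis_family_def
    using inj img[of "{\<mu>. is_partition \<mu>}"] independent_mset_mult Sym_eq_span
    by (auto simp: mset_image_partitions)
qed

end

section \<open>Nifty families\<close>

text \<open>The position tags keep the components disjoint, so induction over initial segments of
  the list splits off one factor at a time.\<close>

lemma chromatic_sf_union_graph:
  assumes "\<And>k. k \<in> set \<mu> \<Longrightarrow> weighted_graph (G k) (w k)"
  shows "chromatic_sf (union_graph G \<mu>) (union_weight w \<mu>) = (\<Prod>k\<leftarrow>\<mu>. chromatic_sf (G k) (w k))"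
proof -
  define V where "V i = Pair i ` verts (G (\<mu> ! i))" for i
  define E where "E i = map_prod (Pair i) (Pair i) ` arcs_ends (G (\<mu> ! i))" for i
  let ?w = "union_weight w \<mu>"
  have wg: "weighted_graph (G (\<mu> ! i)) (w (\<mu> ! i))" if "i < length \<mu>" for i
    using assms that by simp
  have sub: "arcs_ends (G (\<mu> ! i)) \<subseteq> verts (G (\<mu> ! i)) \<times> verts (G (\<mu> ! i))"
    if "i < length \<mu>" for i
  proof -
    interpret pseudo_graph "G (\<mu> ! i)" using wg[OF that] by (simp add: weighted_graph_def)
    show ?thesis by (auto simp: arcs_ends_conv)
  qed
  have V: "finite (V i)" "\<And>v. v \<in> V i \<Longrightarrow> ?w v > 0" "E i \<subseteq> V i \<times> V i" if "i < length \<mu>" for i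
  proof -
    interpret pseudo_graph "G (\<mu> ! i)" using wg[OF that] by (simp add: weighted_graph_def)
    show "finite (V i)" by (simp add: V_def)
    show "?w v > 0" if "v \<in> V i" for v
      using that wg[OF \<open>i < length \<mu>\<close>] by (auto simp: V_def union_weight_def weighted_graph_def)
    show "E i \<subseteq> V i \<times> V i" using sub[OF that] by (auto simp: E_def V_def)
  qed
  \<comment> \<open>Tagging with \<open>Pair i\<close> is an injective relabelling, which leaves the
    series unchanged.\<close>
  have step: "csf (V i) ?w (E i) = chromatic_sf (G (\<mu> ! i)) (w (\<mu> ! i))" if "i < length \<mu>" for i
    using csf_image[OF _ sub[OF that], of "Pair i" ?w]
    by (simp add: V_def E_def chromatic_sf_eq_csf inj_on_def union_weight_def comp_def)
  have "csf (\<Union>i<n. V i) ?w (\<Union>i<n. E i) = (\<Prod>i<n. chromatic_sf (G (\<mu> ! i)) (w (\<mu> ! i)))"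
    if "n \<le> length \<mu>" for n
    using that
  proof (induction n)
    case 0
    then show ?case by (simp add: csf_empty)
  next
    case (Suc n)
    have "csf ((\<Union>i<n. V i) \<union> V n) ?w ((\<Union>i<n. E i) \<union> E n) =
        csf (\<Union>i<n. V i) ?w (\<Union>i<n. E i) * csf (V n) ?w (E n)"
    proof (rule csf_disjoint_Un)
      show "(\<Union>i<n. V i) \<inter> V n = {}" by (auto simp: V_def)
      show "(\<Union>i<n. E i) \<subseteq> (\<Union>i<n. V i) \<times> (\<Union>i<n. V i)"
      proof (rule UN_least)
        fix i assume i: "i \<in> {..<n}"
        with Suc.prems have "E i \<subseteq> V i \<times> V i" by (intro V(3)) auto
        with i show "E i \<subseteq> (\<Union>i<n. V i) \<times> (\<Union>i<n. V i)" by blast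
      qed
      fix v assume "v \<in> (\<Union>i<n. V i) \<union> V n"
      then obtain i where "v \<in> V i" "i < length \<mu>" using Suc.prems by auto
      then show "?w v > 0" by (intro V(2))
    qed (use V Suc.prems in auto)
    with Suc step[of n] show ?case by (simp add: lessThan_Suc Un_commute mult.commute)
  qed
  from this[of "length \<mu>"]
  have "csf (\<Union>i<length \<mu>. V i) ?w (\<Union>i<length \<mu>. E i) = (\<Prod>k\<leftarrow>\<mu>. chromatic_sf (G k) (w k))"
    by (simp add: prod.list_conv_set_nth atLeast0LessThan)
  moreover have "verts (union_graph G \<mu>) = (\<Union>i<length \<mu>. V i)"
    by (auto simp: union_graph_def V_def)
  moreover have "arcs_ends (union_graph G \<mu>) = (\<Union>i<length \<mu>. E i)"
    by (force simp: union_graph_def E_def arcs_ends_conv)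
  ultimately show ?thesis by (simp add: chromatic_sf_eq_csf)
qed

text \<open>The component weights add up to the sum of the parts. Through the product formula for
  unions, this gives the second assumption of \<open>Sym_homog_eq_span\<close>.\<close>

lemma union_graph_in_Sym_homog:
  assumes "nifty G w" "\<And>k. k \<in> set \<mu> \<Longrightarrow> k > 0"
  shows "chromatic_sf (union_graph G \<mu>) (union_weight w \<mu>) \<in> Sym_homog (sum_list \<mu>)"
proof -
  have G: "pseudo_graph (G (\<mu> ! i))" "(\<Sum>v\<in>verts (G (\<mu> ! i)). w (\<mu> ! i) v) = \<mu> ! i"
    if "i < length \<mu>" for i
    using assms(1) assms(2)[of "\<mu> ! i"] that
    by (auto simp: nifty_def weighted_graph_def Suc_le_eq)
  let ?H = "union_graph G \<mu>"
  have "arcs_ends ?H \<subseteq> verts ?H \<times> verts ?H"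
  proof -
    have "tail (G (\<mu> ! i)) e \<in> verts (G (\<mu> ! i)) \<and> head (G (\<mu> ! i)) e \<in> verts (G (\<mu> ! i))"
      if "i < length \<mu>" "e \<in> arcs (G (\<mu> ! i))" for i e
    proof -
      interpret pseudo_graph "G (\<mu> ! i)" using G(1)[OF that(1)] .
      show ?thesis using that(2) by simp
    qed
    then show ?thesis by (auto simp: union_graph_def arcs_ends_conv)
  qed
  moreover have "sum (union_weight w \<mu>) (verts ?H) = sum_list \<mu>"
  proof -
    have fin: "finite (verts (G (\<mu> ! i)))" if "i < length \<mu>" for i
    proof -
      interpret pseudo_graph "G (\<mu> ! i)" using G(1)[OF that] .
      show ?thesis by simp
    qed
    have "sum (union_weight w \<mu>) (verts ?H) = (\<Sum>i<length \<mu>. \<Sum>v\<in>verts (G (\<mu> ! i)). w (\<mu> ! i) v)"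
      unfolding union_graph_def union_weight_def using fin by (simp add: sum.Sigma)
    also have "\<dots> = sum_list \<mu>"
      using G(2) by (simp add: sum_list_sum_nth atLeast0LessThan)
    finally show ?thesis .
  qed
  ultimately show ?thesis
    using csf_in_Sym_homog[of "arcs_ends ?H" "verts ?H" "union_weight w \<mu>"]
    by (simp add: chromatic_sf_eq_csf)
qed

text \<open>The arcs of an undirected graph come in both directions, so connectedness already
  provides directed paths.\<close>

lemma connected_graph_rtrancl:
  assumes "graph G" "Digraph_Component.connected G"
  shows "verts G \<noteq> {}" "verts G \<times> verts G \<subseteq> (arcs_ends G)\<^sup>*"
proof -
  interpret graph G by fact
  have "strongly_connected G"
    using sym_arcs assms(2) by (rule symmetric_connected_imp_strongly_connected)
  then show "verts G \<noteq> {}" "verts G \<times> verts G \<subseteq> (arcs_ends G)\<^sup>*"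
    by (auto simp: strongly_connected_def intro: reachable_rtranclI)
qed

lemma nifty_power_sum_expansion:
  assumes "nifty G w" "n > 0"
  shows "\<exists>c\<noteq>0. chromatic_sf (G n) (w n) - mps_scale c (power_sum n)
      \<in> mps.span (mset_mult power_sum ` {M \<in> mpartitions n. size M \<ge> 2})"
proof -
  have G: "graph (G n)" "Digraph_Component.connected (G n)" "\<And>v. v \<in> verts (G n) \<Longrightarrow> w n v > 0"
    "sum (w n) (verts (G n)) = n"
    using assms by (auto simp: nifty_def weighted_graph_def Suc_le_eq)
  interpret graph "G n" by fact
  let ?V = "verts (G n)" and ?E = "arcs_ends (G n)"
  have "\<exists>c\<ge>0. (?V \<times> ?V \<subseteq> ?E\<^sup>* \<longrightarrow> c > 0) \<and>
    csf ?V (w n) ?E - mps_scale ((- 1) ^ Suc (card ?V) * c) (power_sum (sum (w n) ?V))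
      \<in> mps.span (mset_mult power_sum ` {M \<in> mpartitions (sum (w n) ?V). size M \<ge> 2})"
  proof (rule csf_power_sum_expansion)
    show "?E \<subseteq> ?V \<times> ?V" by (auto simp: arcs_ends_conv)
    show "sym ?E" using sym_arcs by (simp add: symmetric_def)
    show "irrefl ?E" using no_loops by (auto simp: irrefl_def arcs_ends_conv)
  qed (use G connected_graph_rtrancl in auto)
  \<comment> \<open>Connectedness turns \<open>c \<ge> 0\<close> into \<open>c > 0\<close>, and the
    sign cannot make the coefficient vanish.\<close>
  then obtain c where c: "c > 0" "csf ?V (w n) ?E - mps_scale ((- 1) ^ Suc (card ?V) * c) (power_sum n)
      \<in> mps.span (mset_mult power_sum ` {M \<in> mpartitions n. size M \<ge> 2})"
    using connected_graph_rtrancl(2)[OF G(1,2)] unfolding G(4) by blast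
  then show ?thesis
    by (intro exI[of _ "(- 1) ^ Suc (card ?V) * c"]) (simp add: chromatic_sf_eq_csf)
qed

theorem theorem5p4:
  fixes G :: "nat \<Rightarrow> ('a, 'b) pre_digraph" and w :: "nat \<Rightarrow> 'a \<Rightarrow> nat"
  assumes "nifty G w"
  shows "multiplicative_basis (\<lambda>\<mu>. chromatic_sf (union_graph G \<mu>) (union_weight w \<mu>)) \<and>
    alg_independent (\<lambda>n. chromatic_sf (G n) (w n)) {1..} \<and>
    freely_generates (\<lambda>n. chromatic_sf (G n) (w n)) {1..} Sym"
proof -
  let ?x = "\<lambda>n. chromatic_sf (G n) (w n)"
  have union: "chromatic_sf (union_graph G \<mu>) (union_weight w \<mu>) = (\<Prod>k\<leftarrow>\<mu>. ?x k)"
    if "0 \<notin> set \<mu>" for \<mu>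
    using assms that by (intro chromatic_sf_union_graph) (metis nifty_def not_gr0 Suc_le_eq One_nat_def)
  interpret multiplicative_sequence ?x
  proof (unfold_locales, rule Sym_homog_eq_span)
    fix n M assume M: "M \<in> mpartitions n"
    \<comment> \<open>Any listing of \<open>M\<close> gives a union graph whose series is the
      product over \<open>M\<close>.\<close>
    obtain \<mu> where \<mu>: "M = mset \<mu>" by (metis ex_mset)
    have "mset_mult ?x M = (\<Prod>k\<leftarrow>\<mu>. ?x k)"
      by (simp add: \<mu> mset_mult_def prod_mset_prod_list flip: mset_map)
    moreover have "sum_list \<mu> = n" "0 \<notin> set \<mu>"
      using M by (auto simp: \<mu> mpartitions_def sum_mset_sum_list)
    ultimately show "mset_mult ?x M \<in> Sym_homog n"
      using union_graph_in_Sym_homog[OF assms, of \<mu>] union[of \<mu>] by (metis not_gr0)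
  qed (rule nifty_power_sum_expansion[OF assms])
  have "multiplicative_basis (\<lambda>\<mu>. chromatic_sf (union_graph G \<mu>) (union_weight w \<mu>))"
    by (rule multiplicative_basisI, rule union) (auto simp: is_partition_def)
  then show ?thesis
    using alg_independent_x generated_subalgebra_eq_Sym by (simp add: freely_generates_def)
qed

end
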